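(* For fixed $k\ge1$ we have $$\log|C(k,m)|=\log|B(k,m)|-\mathcal{O}(\log m)\qquad\text{for }m\to\infty.$$
   Context: The Segre zonoid $C(k,m)\subseteq\mathbb{R}^{k\times m}$ (for $k\le m$) is the zonoid $\mathbb{E}\,[0,xy^T]$ associated with the random matrix $xy^T$, where $x\in\mathbb{R}^k$, $y\in\mathbb{R}^m$ are independent standard Gaussian vectors; i.e. the convex body whose support function is $h_{C(k,m)}(X)=\frac12\mathbb{E}\,|\langle X,xy^T\rangle|$ with $\langle X,Y\rangle=\operatorname{tr}(X^TY)$. Further, $$B(k,m):=\Big\{X\in\mathbb{R}^{k\times m}\ \Big|\ \|X\|_F\le\frac{1}{\sqrt{2\pi}}\frac{\rho_k}{\sqrt k}\Big\},\qquad\rho_k:=\frac{\sqrt2\,\Gamma(\frac{k+1}{2})}{\Gamma(\frac k2)},$$ where $\|\cdot\|_F$ is the Frobenius norm. $|\cdot|$ denotes Lebesgue volume in $\mathbb{R}^{k\times m}\simeq\mathbb{R}^{km}$. $\mathcal{O}(\log m)$ denotes a quantity bounded in absolute value by a constant (depending on $k$) times $\log m$ for all large $m$. *)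

theory Defs
  imports "HOL-Probability.Probability" "HOL-Library.Landau_Symbols"
begin

text \<open>
  The number of columns tends to infinity, so it cannot be a type. A real \<open>k\<close> by \<open>m\<close> matrix is an
  extensional function on the index set; thus a set of matrices is compact in the product topology
  of \<^typ>\<open>nat \<times> nat \<Rightarrow> real\<close> iff it is compact in the Euclidean space of \<open>k\<close> by \<open>m\<close> matrices.
\<close>

definition mat_idx :: "nat \<Rightarrow> nat \<Rightarrow> (nat \<times> nat) set" where
  "mat_idx k m = {..<k} \<times> {..<m}"

definition mats :: "nat \<Rightarrow> nat \<Rightarrow> (nat \<times> nat \<Rightarrow> real) set" where
  "mats k m = (\<Pi>\<^sub>E p\<in>mat_idx k m. UNIV)"

text \<open>The trace of the product of the transpose of \<open>X\<close> with \<open>Y\<close>.\<close>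

definition mat_inner :: "nat \<Rightarrow> nat \<Rightarrow> (nat \<times> nat \<Rightarrow> real) \<Rightarrow> (nat \<times> nat \<Rightarrow> real) \<Rightarrow> real" where
  "mat_inner k m X Y = (\<Sum>j<m. \<Sum>i<k. X (i, j) * Y (i, j))"

definition frob_norm :: "nat \<Rightarrow> nat \<Rightarrow> (nat \<times> nat \<Rightarrow> real) \<Rightarrow> real" where
  "frob_norm k m X = sqrt (mat_inner k m X X)"

definition mat_lebesgue :: "nat \<Rightarrow> nat \<Rightarrow> (nat \<times> nat \<Rightarrow> real) measure" where
  "mat_lebesgue k m = (\<Pi>\<^sub>M p\<in>mat_idx k m. lborel)"

definition mat_volume :: "nat \<Rightarrow> nat \<Rightarrow> (nat \<times> nat \<Rightarrow> real) set \<Rightarrow> real" where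
  "mat_volume k m K = measure (mat_lebesgue k m) K"

definition mat_convex :: "nat \<Rightarrow> nat \<Rightarrow> (nat \<times> nat \<Rightarrow> real) set \<Rightarrow> bool" where
  "mat_convex k m K \<longleftrightarrow>
     (\<forall>X\<in>K. \<forall>Y\<in>K. \<forall>t\<in>{0..1}. (\<lambda>p\<in>mat_idx k m. (1 - t) * X p + t * Y p) \<in> K)"

text \<open>Convex bodies are not required to have interior points.\<close>

definition convex_body :: "nat \<Rightarrow> nat \<Rightarrow> (nat \<times> nat \<Rightarrow> real) set \<Rightarrow> bool" where
  "convex_body k m K \<longleftrightarrow> K \<subseteq> mats k m \<and> K \<noteq> {} \<and> compact K \<and> mat_convex k m K"

definition support_function ::
    "nat \<Rightarrow> nat \<Rightarrow> (nat \<times> nat \<Rightarrow> real) set \<Rightarrow> (nat \<times> nat \<Rightarrow> real) \<Rightarrow> real" where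
  "support_function k m K X = (SUP Y\<in>K. mat_inner k m X Y)"

definition std_gaussian :: "nat \<Rightarrow> (nat \<Rightarrow> real) measure" where
  "std_gaussian n = (\<Pi>\<^sub>M i\<in>{..<n}. density lborel std_normal_density)"

definition outer_prod :: "nat \<Rightarrow> nat \<Rightarrow> (nat \<Rightarrow> real) \<Rightarrow> (nat \<Rightarrow> real) \<Rightarrow> nat \<times> nat \<Rightarrow> real" where
  "outer_prod k m x y = (\<lambda>(i, j)\<in>mat_idx k m. x i * y j)"

definition segre_support :: "nat \<Rightarrow> nat \<Rightarrow> (nat \<times> nat \<Rightarrow> real) \<Rightarrow> real" where
  "segre_support k m X =
     1 / 2 * (\<integral>(x, y). \<bar>mat_inner k m X (outer_prod k m x y)\<bar> \<partial>(std_gaussian k \<Otimes>\<^sub>M std_gaussian m))"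

text \<open>A convex body is determined by its support function. The function here is that of the
  expectation of the random segment joining the origin to the outer product of two
  independent standard Gaussian vectors.\<close>

definition segre_zonoid :: "nat \<Rightarrow> nat \<Rightarrow> (nat \<times> nat \<Rightarrow> real) set" where
  "segre_zonoid k m =
     (THE K. convex_body k m K \<and> (\<forall>X\<in>mats k m. support_function k m K X = segre_support k m X))"

definition rho :: "nat \<Rightarrow> real" where
  "rho k = sqrt 2 * Gamma ((real k + 1) / 2) / Gamma (real k / 2)"

definition segre_ball :: "nat \<Rightarrow> nat \<Rightarrow> (nat \<times> nat \<Rightarrow> real) set" where
  "segre_ball k m = {X \<in> mats k m. frob_norm k m X \<le> 1 / sqrt (2 * pi) * (rho k / sqrt (real k))}"

end

theory Submission
  imports Defs
begin

text \<open>Conditioning on the left Gaussian vector shows that the support function of the zonoid is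
  \<open>E |X\<^sup>T x| / sqrt (2 pi)\<close>. The one probabilistic fact needed beyond this is that
  \<open>E (x\<^sub>i x\<^sub>l / |x|)\<close> vanishes for \<open>i \<noteq> l\<close> and equals \<open>rho k / k\<close> for \<open>i = l\<close>
  (\<open>matrix_form_over_norm\<close>). With \<open>r = rho k / (k sqrt (2 pi))\<close>, so that \<open>segre_ball\<close> has radius
  \<open>r sqrt k\<close>, the Cauchy-Schwarz inequality applied to \<open>|X\<^sup>T x|\<close> in two different ways yields
  \<open>U \<subseteq> C \<subseteq> B\<close>: here \<open>U\<close> is the spectral norm ball of radius \<open>r\<close>, \<open>C\<close> the zonoid and \<open>B\<close>
  the Frobenius ball (\<open>spectral_ball_subset_segre_body\<close>, \<open>segre_body_subset_ball\<close>). Both inclusions are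
  sharp at the matrices with all singular values equal to \<open>r\<close>.

  It remains to see that \<open>U\<close> fills a polynomial fraction of \<open>B\<close>. Since \<open>k\<close> is fixed, the \<open>k\<close> by
  \<open>k\<close> Gram matrices \<open>X X\<^sup>T\<close> of the points of \<open>B\<close> can be covered by polynomially many boxes of size
  of order \<open>1 / m\<close>, and the preimage of one such box is a cell. On the cell around \<open>X\<^sub>0\<close> one has
  \<open>X X\<^sup>T \<le> X\<^sub>0 X\<^sub>0\<^sup>T + (r\<^sup>2 / m) I\<close>. If the right-hand side is
  \<open>r\<^sup>2 L L\<^sup>T\<close> with \<open>L\<close> lower triangular, then \<open>X \<mapsto> L\<^sup>-\<^sup>1 X\<close> maps the cell into \<open>U\<close>. It divides
  volume by \<open>(det L)\<^sup>m\<close>, and the trace bound \<open>tr (X\<^sub>0 X\<^sub>0\<^sup>T) \<le> k r\<^sup>2\<close> that defines \<open>B\<close> gives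
  \<open>det L \<le> exp (k / (2 m))\<close>, so every cell has at most \<open>exp (k / 2)\<close> times the volume of \<open>U\<close>
  (\<open>emeasure_gram_cell_le\<close>).

  The zonoid is given only by a description of its support function, so its existence and uniqueness
  are part of the argument: uniqueness follows by separation with a closest point, and existence from
  explicit subgradients (\<open>segre_support_attained\<close>).\<close>

section \<open>Matrices as extensional functions\<close>

text \<open>The value at \<open>u\<close> of the quadratic form of the matrix \<open>X X\<^sup>T\<close>, that is, the squared
  Euclidean norm of \<open>X\<^sup>T u\<close>.\<close>

definition gram_form :: "nat \<Rightarrow> nat \<Rightarrow> (nat \<times> nat \<Rightarrow> real) \<Rightarrow> (nat \<Rightarrow> real) \<Rightarrow> real" where
  "gram_form k m X u = (\<Sum>j<m. (\<Sum>i<k. u i * X (i, j))\<^sup>2)"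

lemma gram_form_nonneg [simp]: "0 \<le> gram_form k m X u"
  by (simp add: gram_form_def sum_nonneg)

lemma finite_mat_idx [simp]: "finite (mat_idx k m)"
  by (simp add: mat_idx_def)

lemma mat_inner_alt: "mat_inner k m X Y = (\<Sum>p\<in>mat_idx k m. X p * Y p)"
  unfolding mat_inner_def mat_idx_def
  by (subst sum.swap) (simp add: sum.cartesian_product case_prod_unfold)

lemma mat_inner_self: "mat_inner k m X X = (frob_norm k m X)\<^sup>2"
  by (simp add: frob_norm_def mat_inner_def sum_nonneg)

lemma entry_le_frob_norm: "p \<in> mat_idx k m \<Longrightarrow> \<bar>X p\<bar> \<le> frob_norm k m X"
proof -
  assume "p \<in> mat_idx k m"
  then have "(X p)\<^sup>2 \<le> mat_inner k m X X"
    unfolding mat_inner_alt power2_eq_square by (intro member_le_sum) auto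
  then show ?thesis
    unfolding frob_norm_def by (metis real_sqrt_abs real_sqrt_le_iff)
qed

lemma frob_norm_nonneg: "0 \<le> frob_norm k m X"
  unfolding frob_norm_def mat_inner_def by (intro real_sqrt_ge_zero sum_nonneg) simp

lemma closed_mats: "closed (mats k m)"
proof -
  have "mats k m = (\<Inter>p\<in>- mat_idx k m. {X. X p = undefined})"
    by (auto simp: mats_def PiE_def extensional_def)
  moreover have "closed {X :: nat \<times> nat \<Rightarrow> real. X p = undefined}" for p
    by (intro closed_Collect_eq continuous_on_product_coordinates continuous_on_const)
  ultimately show ?thesis by auto
qed

lemma continuous_on_mat_inner [continuous_intros]:
  "continuous_on S f \<Longrightarrow> continuous_on S g \<Longrightarrow> continuous_on S (\<lambda>x. mat_inner k m (f x) (g x))"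
  unfolding mat_inner_def
  by (intro continuous_intros; erule continuous_on_product_then_coordinatewise)

lemma compact_mat_box: "compact ({X \<in> mats k m. \<forall>p\<in>mat_idx k m. \<bar>X p\<bar> \<le> c})"
proof -
  let ?S = "\<lambda>p. if p \<in> mat_idx k m then {-c..c} else {undefined}"
  have "{X \<in> mats k m. \<forall>p\<in>mat_idx k m. \<bar>X p\<bar> \<le> c} = PiE UNIV ?S"
  proof (intro set_eqI iffI)
    fix X assume X: "X \<in> PiE UNIV ?S"
    then have "X p \<in> ?S p" for p by (rule PiE_mem) simp
    then show "X \<in> {X \<in> mats k m. \<forall>p\<in>mat_idx k m. \<bar>X p\<bar> \<le> c}"
      by (force simp: mats_def PiE_iff extensional_def abs_le_iff split: if_splits)
  qed (auto simp: mats_def PiE_iff extensional_def abs_le_iff)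
  moreover have "compactin (product_topology (\<lambda>_. euclidean) UNIV) (PiE UNIV ?S)"
    by (subst compactin_PiE) auto
  ultimately show ?thesis
    by (simp add: euclidean_product_topology)
qed

text \<open>The Borel sets of the full function space trace the product
  \<open>\<sigma>\<close>-algebra on the matrices, because a matrix is constant outside its finite index set.\<close>

lemma closed_imp_sets_mat_lebesgue:
  assumes "closed S" "S \<subseteq> mats k m"
  shows "S \<in> sets (mat_lebesgue k m)"
proof -
  have "(\<lambda>X. X) \<in> measurable (mat_lebesgue k m) (borel :: (nat \<times> nat \<Rightarrow> real) measure)"
  proof (rule measurable_coordinatewise_then_product)
    fix p
    show "(\<lambda>X. X p) \<in> borel_measurable (mat_lebesgue k m)"
    proof (cases "p \<in> mat_idx k m")
      case True
      then have "(\<lambda>X. X p) \<in> measurable (mat_lebesgue k m) lborel"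
        unfolding mat_lebesgue_def by (rule measurable_component_singleton)
      then show ?thesis by simp
    next
      case False
      then have "(\<lambda>X. X p) \<in> borel_measurable (mat_lebesgue k m)
        \<longleftrightarrow> (\<lambda>X. undefined :: real) \<in> borel_measurable (mat_lebesgue k m)"
        by (intro measurable_cong, cases p) (simp add: mat_lebesgue_def space_PiM PiE_iff extensional_def)
      then show ?thesis by simp
    qed
  qed
  moreover have "S \<in> sets borel" using assms by simp
  ultimately have "(\<lambda>X. X) -` S \<inter> space (mat_lebesgue k m) \<in> sets (mat_lebesgue k m)"
    by (rule measurable_sets)
  moreover have "(\<lambda>X. X) -` S \<inter> space (mat_lebesgue k m) = S"
    using assms(2) by (auto simp: mat_lebesgue_def space_PiM mats_def)
  ultimately show ?thesis by simp
qed

section \<open>Convex bodies and support functions\<close>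

text \<open>If \<open>P\<close> is the point of \<open>K\<close> closest to \<open>Z\<close>, then \<open>Z - P\<close> is a separating direction:
  a point of \<open>K\<close> beyond \<open>P\<close> in this direction could be used to move \<open>P\<close> closer to \<open>Z\<close> inside \<open>K\<close>.\<close>

lemma support_function_separates:
  assumes K: "convex_body k m K" and Z: "Z \<in> mats k m" "Z \<notin> K"
  obtains W where "W \<in> mats k m" "support_function k m K W < mat_inner k m W Z"
proof -
  let ?D = "\<lambda>Y. (\<lambda>p\<in>mat_idx k m. Z p - Y p)"
  let ?f = "\<lambda>Y. mat_inner k m (\<lambda>p. Z p - Y p) (\<lambda>p. Z p - Y p)"
  have fD: "mat_inner k m (?D P) Y = mat_inner k m (\<lambda>p. Z p - P p) Y" for P Y
    by (simp add: mat_inner_alt)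
  have "continuous_on K ?f"
    unfolding mat_inner_def
    by (intro continuous_intros) (auto intro: continuous_on_subset[OF continuous_on_product_coordinates])
  then obtain P where P: "P \<in> K" "\<And>Y. Y \<in> K \<Longrightarrow> ?f P \<le> ?f Y"
    using K continuous_attains_inf[of K ?f] unfolding convex_body_def by blast
  have Pm: "P \<in> mats k m" using P(1) K by (auto simp: convex_body_def)
  have pos: "0 < ?f P"
  proof -
    have "P \<noteq> Z" using P Z by auto
    then obtain p where p: "p \<in> mat_idx k m" "P p \<noteq> Z p"
      using Pm Z(1) unfolding mats_def by (metis PiE_ext)
    then show ?thesis unfolding mat_inner_alt
      by (intro sum_pos2[of _ p]) (auto simp: zero_less_mult_iff linorder_neq_iff)
  qed
  have le: "mat_inner k m (?D P) Y \<le> mat_inner k m (?D P) P" if Y: "Y \<in> K" for Y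
  proof (rule ccontr)
    define a where "a = mat_inner k m (\<lambda>p. Z p - P p) (\<lambda>p. Y p - P p)"
    define b where "b = mat_inner k m (\<lambda>p. Y p - P p) (\<lambda>p. Y p - P p)"
    have b0: "b \<ge> 0" unfolding b_def mat_inner_def by (intro sum_nonneg) auto
    assume "\<not> ?thesis"
    then have a: "a > 0"
      by (simp add: a_def fD) (simp add: mat_inner_def algebra_simps sum_subtractf sum.distrib)
    \<comment> \<open>At this \<open>t\<close> the squared distance \<open>|Z - P|\<^sup>2 - 2 t a + t\<^sup>2 b\<close> has decreased; the \<open>1\<close> added to \<open>b\<close> avoids a division by zero.\<close>
    define t where "t = min 1 (a / (b + 1))"
    have t: "0 < t" "t \<le> 1" "t * b < 2 * a"
    proof -
      show "0 < t" "t \<le> 1" using a b0 by (auto simp: t_def)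
      have "t * b \<le> a / (b + 1) * b" unfolding t_def using b0 by (intro mult_right_mono) auto
      also have "\<dots> < 2 * a" using a b0 by (simp add: field_simps add_nonneg_pos)
      finally show "t * b < 2 * a" .
    qed
    let ?Y = "\<lambda>p\<in>mat_idx k m. (1 - t) * P p + t * Y p"
    have "?Y \<in> K" using K P(1) Y t unfolding convex_body_def mat_convex_def by auto
    then have "?f P \<le> ?f ?Y" by (rule P(2))
    also have "?f ?Y = ?f P - 2 * t * a + t\<^sup>2 * b"
    proof -
      have "(Z p - ?Y p) * (Z p - ?Y p) = (Z p - P p) * (Z p - P p)
          - 2 * t * ((Z p - P p) * (Y p - P p)) + t\<^sup>2 * ((Y p - P p) * (Y p - P p))"
        if "p \<in> mat_idx k m" for p
        using that by (simp add: algebra_simps power2_eq_square)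
      then show ?thesis
        by (simp add: mat_inner_alt a_def b_def sum.distrib sum_subtractf sum_distrib_left)
    qed
    finally have "2 * t * a \<le> t * (t * b)" by (simp add: power2_eq_square)
    also have "\<dots> < t * (2 * a)" using t by (intro mult_strict_left_mono) auto
    finally show False by simp
  qed
  have "support_function k m K (?D P) \<le> mat_inner k m (?D P) P"
    unfolding support_function_def using P(1) le by (intro cSUP_least) auto
  also have "\<dots> < mat_inner k m (?D P) Z"
    using pos
    by (simp add: fD) (simp add: mat_inner_alt right_diff_distrib sum_subtractf)
  finally show ?thesis by (intro that[of "?D P"]) (auto simp: mats_def)
qed

lemma inner_le_support_function:
  assumes "convex_body k m K" "Y \<in> K"
  shows "mat_inner k m X Y \<le> support_function k m K X"
proof -
  have "continuous_on K (\<lambda>Y. mat_inner k m X Y)"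
    by (intro continuous_intros continuous_on_id)
  then have "bdd_above ((\<lambda>Y. mat_inner k m X Y) ` K)"
    using assms compact_continuous_image bounded_imp_bdd_above compact_imp_bounded
    unfolding convex_body_def by metis
  then show ?thesis unfolding support_function_def using assms(2) by (rule cSUP_upper[rotated])
qed

lemma support_function_eqD:
  assumes "convex_body k m K" "convex_body k m K'"
    and "\<And>X. X \<in> mats k m \<Longrightarrow> support_function k m K X = support_function k m K' X"
  shows "K = K'"
proof -
  have "A \<subseteq> B" if "convex_body k m A" "convex_body k m B"
    "\<And>X. X \<in> mats k m \<Longrightarrow> support_function k m A X = support_function k m B X" for A B
  proof
    fix Z assume Z: "Z \<in> A"
    then have Zm: "Z \<in> mats k m" using that by (auto simp: convex_body_def)
    show "Z \<in> B"
    proof (rule ccontr)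
      assume "Z \<notin> B"
      from support_function_separates[OF that(2) Zm this] obtain W
        where "W \<in> mats k m" "support_function k m B W < mat_inner k m W Z" .
      with inner_le_support_function[OF that(1) Z, of W] that(3) show False by fastforce
    qed
  qed
  from this[of K K'] this[of K' K] assms show ?thesis by auto
qed

section \<open>Moments of Gaussian coordinates\<close>

abbreviation std_normal :: "real measure" where
  "std_normal \<equiv> density lborel (\<lambda>x. ennreal (std_normal_density x))"

lemma prob_space_std_normal: "prob_space std_normal"
  by (rule prob_space_normal_density) simp

lemma finite_product_prob_space_std_normal:
  "finite I \<Longrightarrow> finite_product_prob_space (\<lambda>_. std_normal) I"
  by (intro finite_product_prob_space.intro product_prob_spaceI
      finite_product_sigma_finite.intro finite_product_sigma_finite_axioms.intro
      product_sigma_finite.intro prob_space_imp_sigma_finite prob_space_std_normal)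

lemma prob_space_std_gaussian: "prob_space (std_gaussian n)"
  unfolding std_gaussian_def by (intro prob_space_PiM prob_space_std_normal)

lemma measurable_coordinate_std_gaussian [simp]:
  "i < n \<Longrightarrow> (\<lambda>x. x i) \<in> borel_measurable (std_gaussian n)"
  using measurable_component_singleton[of i "{..<n}" "\<lambda>_. std_normal"]
  by (simp add: std_gaussian_def)

lemma std_normal_moments:
  "integrable std_normal (\<lambda>x. x)" "(\<integral>x. x \<partial>std_normal) = 0"
  "integrable std_normal (\<lambda>x. \<bar>x\<bar>)" "(\<integral>x. \<bar>x\<bar> \<partial>std_normal) = sqrt (2 / pi)"
  "integrable std_normal (\<lambda>x. x\<^sup>2)"
  using integrable_std_normal_moment[of 1] integral_std_normal_moment_odd[of 0]
    integrable_std_normal_moment_abs[of 1] integral_std_normal_moment_abs_odd[of 0]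
    integrable_std_normal_moment[of 2]
  by (simp_all add: integrable_density integral_density)

lemma std_gaussian_coordinate:
  assumes "i < n" and [measurable]: "f \<in> borel_measurable borel"
  shows "integrable (std_gaussian n) (\<lambda>x. f (x i)) \<longleftrightarrow> integrable std_normal (f :: real \<Rightarrow> real)"
    and "(\<integral>x. f (x i) \<partial>std_gaussian n) = (\<integral>x. f x \<partial>std_normal)"
proof -
  have *: "distr (std_gaussian n) std_normal (\<lambda>x. x i) = std_normal"
    unfolding std_gaussian_def using assms(1)
    by (intro distr_PiM_component prob_space_std_normal) auto
  have [measurable]: "(\<lambda>x. x i) \<in> measurable (std_gaussian n) std_normal"
    using assms by simp
  have [measurable]: "f \<in> borel_measurable std_normal" using assms by simp
  show "integrable (std_gaussian n) (\<lambda>x. f (x i)) \<longleftrightarrow> integrable std_normal f"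
    using integrable_distr_eq[of "\<lambda>x. x i" "std_gaussian n" std_normal f] assms(1) by (simp add: *)
  show "(\<integral>x. f (x i) \<partial>std_gaussian n) = (\<integral>x. f x \<partial>std_normal)"
    using integral_distr[of "\<lambda>x. x i" "std_gaussian n" std_normal f] assms(1) by (simp add: *)
qed

text \<open>A linear combination of independent standard normal variables is normal with variance the
  sum of the squared coefficients. The density of a normal variable needs a positive variance, hence the
  restriction to the nonzero coefficients.\<close>

lemma std_gaussian_expectation_abs_linear:
  "(\<integral>y. \<bar>\<Sum>j<n. a j * y j\<bar> \<partial>std_gaussian n) = sqrt (2 / pi) * sqrt (\<Sum>j<n. (a j)\<^sup>2)"
proof -
  interpret prob_space "std_gaussian n" by (rule prob_space_std_gaussian)
  define J where "J = {j\<in>{..<n}. a j \<noteq> 0}"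
  have J: "finite J" "\<And>j. j \<in> J \<Longrightarrow> j < n" "\<And>j. j \<in> J \<Longrightarrow> a j \<noteq> 0" by (auto simp: J_def)
  have 1: "(\<Sum>j<n. a j * y j) = (\<Sum>j\<in>J. a j * y j)" for y
    unfolding J_def by (intro sum.mono_neutral_right) auto
  have 2: "(\<Sum>j<n. (a j)\<^sup>2) = (\<Sum>j\<in>J. (a j)\<^sup>2)"
    unfolding J_def by (intro sum.mono_neutral_right) auto
  show ?thesis
  proof (cases "J = {}")
    case True
    then show ?thesis unfolding 1 2 by simp
  next
    case False
    have cd: "distr (std_gaussian n) borel (\<lambda>y. y j) = std_normal" if "j < n" for j
    proof -
      have "distr (std_gaussian n) borel (\<lambda>y. y j) = distr (std_gaussian n) std_normal (\<lambda>y. y j)"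
        by (intro distr_cong) auto
      also have "\<dots> = std_normal"
        unfolding std_gaussian_def using that
        by (intro distr_PiM_component prob_space_std_normal) auto
      finally show ?thesis .
    qed
    have "indep_vars (\<lambda>_. borel) (\<lambda>j y. y j) {..<n}"
    proof (subst indep_vars_iff_distr_eq_PiM')
      show "{..<n} \<noteq> {}" using False J by auto
      have "distr (std_gaussian n) (Pi\<^sub>M {..<n} (\<lambda>i. borel)) (\<lambda>x. \<lambda>i\<in>{..<n}. x i)
          = distr (std_gaussian n) (std_gaussian n) (\<lambda>x. x)"
        by (intro distr_cong)
           (auto simp: std_gaussian_def space_PiM PiE_iff extensional_restrict intro!: sets_PiM_cong)
      also have "\<dots> = std_gaussian n" by simp
      also have "\<dots> = (\<Pi>\<^sub>M i\<in>{..<n}. distr (std_gaussian n) borel (\<lambda>x. x i))"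
        unfolding std_gaussian_def
        by (intro PiM_cong) (auto simp: cd[unfolded std_gaussian_def])
      finally show "distr (std_gaussian n) (Pi\<^sub>M {..<n} (\<lambda>i. borel)) (\<lambda>x. \<lambda>i\<in>{..<n}. x i)
          = (\<Pi>\<^sub>M i\<in>{..<n}. distr (std_gaussian n) borel (\<lambda>x. x i))" .
    qed auto
    then have "indep_vars (\<lambda>_. borel) (\<lambda>j y. y j) J"
      by (rule indep_vars_subset) (auto simp: J_def)
    then have indep: "indep_vars (\<lambda>_. borel) (\<lambda>j y. a j * y j) J"
      by (rule indep_vars_compose2) auto
    have "distributed (std_gaussian n) lborel (\<lambda>y. 0 + a j * y j) (normal_density (0 + a j * 0) (\<bar>a j\<bar> * 1))"
      if "j \<in> J" for j
      using that J cd[of j] by (intro normal_density_affine) (auto simp: distributed_def cong: distr_cong)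
    then have "distributed (std_gaussian n) lborel (\<lambda>y. \<Sum>j\<in>J. a j * y j)
        (normal_density (\<Sum>j\<in>J. 0) (sqrt (\<Sum>j\<in>J. \<bar>a j\<bar>\<^sup>2)))"
      using J False indep by (intro sum_indep_normal) auto
    then have "(\<integral>x. normal_density 0 (sqrt (\<Sum>j\<in>J. (a j)\<^sup>2)) x * \<bar>x\<bar> \<partial>lborel)
        = (\<integral>y. \<bar>\<Sum>j\<in>J. a j * y j\<bar> \<partial>std_gaussian n)"
      by (intro distributed_integral) auto
    moreover have "0 < sqrt (\<Sum>j\<in>J. (a j)\<^sup>2)"
      using J False by (auto intro!: sum_pos)
    ultimately show ?thesis unfolding 1 2
      using integral_normal_moment_abs_odd[of "sqrt (\<Sum>j\<in>J. (a j)\<^sup>2)" 0 0] by simp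
  qed
qed

section \<open>Gaussian quadratic forms divided by the norm\<close>

lemma nn_integral_Gamma_scaled:
  assumes "a > 0" "c > 0"
  shows "(\<integral>\<^sup>+t. ennreal (indicator {0..} t * t powr (a - 1) * exp (- c * t)) \<partial>lborel)
    = ennreal (Gamma a * c powr (- a))"
proof -
  have "ennreal (Gamma a) = (\<integral>\<^sup>+t. ennreal (indicator {0..} t * t powr (a - 1) / exp t) \<partial>lborel)"
    by (rule Gamma_conv_nn_integral_real) fact
  also have "\<dots> = ennreal c * (\<integral>\<^sup>+t. ennreal (indicator {0..} (0 + c * t) * (0 + c * t) powr (a - 1) / exp (0 + c * t)) \<partial>lborel)"
    using assms by (subst nn_integral_real_affine[where c = c and t = 0]) auto
  also have "\<dots> = (\<integral>\<^sup>+t. ennreal (c powr a) * ennreal (indicator {0..} t * t powr (a - 1) * exp (- c * t)) \<partial>lborel)"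
    using assms
    by (subst nn_integral_cmult[symmetric])
       (auto intro!: nn_integral_cong simp: ennreal_mult'[symmetric] indicator_def powr_mult exp_minus
         powr_diff field_simps zero_le_mult_iff split: if_splits)
  also have "\<dots> = ennreal (c powr a) * (\<integral>\<^sup>+t. ennreal (indicator {0..} t * t powr (a - 1) * exp (- c * t)) \<partial>lborel)"
    by (intro nn_integral_cmult) auto
  finally have *: "ennreal (Gamma a) = ennreal (c powr a) * (\<integral>\<^sup>+t. ennreal (indicator {0..} t * t powr (a - 1) * exp (- c * t)) \<partial>lborel)" .
  have "ennreal (Gamma a * c powr (- a)) = ennreal (c powr (- a)) * ennreal (Gamma a)"
    using assms by (simp add: ennreal_mult' mult.commute)
  also have "\<dots> = ennreal (c powr (- a) * c powr a) * (\<integral>\<^sup>+t. ennreal (indicator {0..} t * t powr (a - 1) * exp (- c * t)) \<partial>lborel)"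
    unfolding * by (simp add: ennreal_mult' mult.assoc)
  also have "c powr (- a) * c powr a = 1" using assms by (simp add: powr_add[symmetric])
  finally show ?thesis by simp
qed

text \<open>The weight \<open>exp (- t x\<^sup>2)\<close> turns the standard normal density into a multiple of the
  normal density with variance \<open>1 / (1 + 2 t)\<close>.\<close>

lemma std_normal_Laplace_square:
  assumes "t \<ge> 0"
  shows "(\<integral>\<^sup>+x. ennreal (exp (- t * x\<^sup>2)) \<partial>std_normal) = ennreal ((1 + 2 * t) powr (- 1/2))" (is ?A)
    and "(\<integral>\<^sup>+x. ennreal (x\<^sup>2 * exp (- t * x\<^sup>2)) \<partial>std_normal) = ennreal ((1 + 2 * t) powr (- 3/2))" (is ?B)
proof -
  define s where "s = 1 / sqrt (1 + 2 * t)"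
  have s: "s > 0" "s\<^sup>2 = 1 / (1 + 2 * t)" using assms by (auto simp: s_def power_divide)
  have s': "s = (1 + 2 * t) powr (- 1/2)"
    using assms by (simp add: s_def powr_minus powr_half_sqrt divide_simps)
  have eq: "std_normal_density x * exp (- t * x\<^sup>2) = s * normal_density 0 s x" for x
  proof -
    have "exp (- x\<^sup>2 / 2) * exp (- t * x\<^sup>2) = exp (- x\<^sup>2 / (2 * s\<^sup>2))"
      unfolding exp_add[symmetric] s(2) using assms by (simp add: field_simps)
    then show ?thesis using s(1)
      by (simp add: normal_density_def real_sqrt_mult field_simps)
  qed
  have "(\<integral>\<^sup>+x. ennreal (exp (- t * x\<^sup>2)) \<partial>std_normal) = (\<integral>\<^sup>+x. ennreal (s * normal_density 0 s x) \<partial>lborel)"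
    by (subst nn_integral_density) (auto simp: ennreal_mult'[symmetric] eq[symmetric])
  also have "\<dots> = ennreal (\<integral>x. s * normal_density 0 s x \<partial>lborel)"
    using s by (intro nn_integral_eq_integral) auto
  also have "\<dots> = ennreal s" using s by simp
  finally show ?A by (simp add: s')
  have "(\<integral>\<^sup>+x. ennreal (x\<^sup>2 * exp (- t * x\<^sup>2)) \<partial>std_normal)
      = (\<integral>\<^sup>+x. ennreal (s * (normal_density 0 s x * (x - 0)^2)) \<partial>lborel)"
  proof (subst nn_integral_density)
    have *: "std_normal_density x * (x\<^sup>2 * exp (- t * x\<^sup>2)) = s * (normal_density 0 s x * (x - 0)^2)" for x
      using arg_cong[OF eq[of x], of "\<lambda>y. x\<^sup>2 * y"] by (simp add: mult_ac)
    have "ennreal (std_normal_density x) * ennreal (x\<^sup>2 * exp (- t * x\<^sup>2))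
        = ennreal (s * (normal_density 0 s x * (x - 0)^2))" for x
      unfolding *[symmetric] by (rule ennreal_mult'[symmetric]) simp
    then show "(\<integral>\<^sup>+x. ennreal (std_normal_density x) * ennreal (x\<^sup>2 * exp (- t * x\<^sup>2)) \<partial>lborel)
      = (\<integral>\<^sup>+x. ennreal (s * (normal_density 0 s x * (x - 0)^2)) \<partial>lborel)"
      by (rule nn_integral_cong)
  qed auto
  also have "\<dots> = ennreal (\<integral>x. s * (normal_density 0 s x * (x - 0)^2) \<partial>lborel)"
    using s integrable_normal_moment[of s 0 2] by (intro nn_integral_eq_integral) auto
  also have "\<dots> = ennreal (s ^ 3)"
    using integral_normal_moment_even[OF s(1), of 0 1]
    by (simp add: power2_eq_square power3_eq_cube mult.assoc)
  also have "s ^ 3 = (1 + 2 * t) powr (- 3/2)"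
    using assms by (simp add: s' powr_power)
  finally show ?B .
qed

lemma powr_minus_half: "0 < x \<Longrightarrow> x powr (- (1/2)) = 1 / sqrt x"
  by (simp add: powr_minus_divide powr_half_sqrt)

text \<open>A Beta integral: the power of \<open>1 + 2 t\<close> is written as a Gamma integral over \<open>s\<close>, and after
  exchanging the integrals the one over \<open>t\<close> is again a Gamma integral.\<close>

lemma nn_integral_powr_half_Beta:
  assumes a: "a > 1/2"
  shows "(\<integral>\<^sup>+t. ennreal (indicator {0..} t * t powr (- 1/2) * (1 + 2 * t) powr (- a)) \<partial>lborel)
    = ennreal (sqrt (pi / 2) * Gamma (a - 1/2) / Gamma a)"
proof -
  define F where "F t s = ennreal (indicator {0..} t * t powr (- 1/2))
     * ennreal (indicator {0..} s * s powr (a - 1) * exp (- (1 + 2 * t) * s))" for t s :: real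
  have Fm: "case_prod F \<in> borel_measurable (lborel \<Otimes>\<^sub>M lborel)"
    unfolding F_def by measurable
  have Ga: "Gamma a > 0" using a by (intro Gamma_real_pos) auto
  have "ennreal (Gamma a) * (\<integral>\<^sup>+t. ennreal (indicator {0..} t * t powr (- 1/2) * (1 + 2 * t) powr (- a)) \<partial>lborel)
     = (\<integral>\<^sup>+t. ennreal (Gamma a) * ennreal (indicator {0..} t * t powr (- 1/2) * (1 + 2 * t) powr (- a)) \<partial>lborel)"
    by (intro nn_integral_cmult[symmetric]) auto
  also have "\<dots> = (\<integral>\<^sup>+t. \<integral>\<^sup>+s. F t s \<partial>lborel \<partial>lborel)"
  proof (intro nn_integral_cong)
    fix t :: real
    have "(\<integral>\<^sup>+s. F t s \<partial>lborel) = ennreal (indicator {0..} t * t powr (- 1/2)) *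
        (\<integral>\<^sup>+s. ennreal (indicator {0..} s * s powr (a - 1) * exp (- (1 + 2 * t) * s)) \<partial>lborel)"
      unfolding F_def by (intro nn_integral_cmult) auto
    also have "\<dots> = ennreal (Gamma a) * ennreal (indicator {0..} t * t powr (- 1/2) * (1 + 2 * t) powr (- a))"
    proof (cases "t \<ge> 0")
      case True
      show ?thesis
        using nn_integral_Gamma_scaled[of a "1 + 2 * t"] a True Ga
        by (simp add: ennreal_mult'[symmetric] mult_ac)
    qed auto
    finally show "ennreal (Gamma a) * ennreal (indicator {0..} t * t powr (- 1/2) * (1 + 2 * t) powr (- a))
       = (\<integral>\<^sup>+s. F t s \<partial>lborel)" ..
  qed
  also have "\<dots> = (\<integral>\<^sup>+s. \<integral>\<^sup>+t. F t s \<partial>lborel \<partial>lborel)"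
    using lborel_pair.Fubini'[OF Fm] by simp
  also have "\<dots> = (\<integral>\<^sup>+s. ennreal (sqrt (pi / 2)) * ennreal (indicator {0..} s * s powr (a - 1/2 - 1) * exp (- 1 * s)) \<partial>lborel)"
  proof (rule nn_integral_cong_AE)
    have "AE s in lborel. s \<noteq> (0::real)" by (rule AE_lborel_singleton)
    then show "AE s in lborel. (\<integral>\<^sup>+t. F t s \<partial>lborel) = ennreal (sqrt (pi / 2)) * ennreal (indicator {0..} s * s powr (a - 1/2 - 1) * exp (- 1 * s))"
    proof eventually_elim
      case (elim s)
      show ?case
      proof (cases "s \<ge> 0")
        case True
        with elim have s: "s > 0" by simp
        have "(\<integral>\<^sup>+t. F t s \<partial>lborel) = (\<integral>\<^sup>+t. ennreal (s powr (a - 1) * exp (- s)) *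
            ennreal (indicator {0..} t * t powr (1/2 - 1) * exp (- (2 * s) * t)) \<partial>lborel)"
        proof (intro nn_integral_cong)
          fix t :: real
          have "exp (- (1 + 2 * t) * s) = exp (- s) * exp (- (2 * s) * t)"
            unfolding exp_add[symmetric] by (simp add: algebra_simps)
          then show "F t s = ennreal (s powr (a - 1) * exp (- s)) *
              ennreal (indicator {0..} t * t powr (1/2 - 1) * exp (- (2 * s) * t))"
            using s unfolding F_def by (simp add: ennreal_mult'[symmetric] mult_ac)
        qed
        also have "\<dots> = ennreal (s powr (a - 1) * exp (- s)) * ennreal (Gamma (1/2) * (2 * s) powr (- (1/2)))"
          unfolding nn_integral_Gamma_scaled[of "1/2" "2 * s", OF half_gt_zero[OF zero_less_one] mult_pos_pos[OF zero_less_numeral s], symmetric]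
          by (intro nn_integral_cmult) auto
        also have "\<dots> = ennreal (sqrt (pi / 2) * (s powr (a - 1/2 - 1) * exp (- s)))"
        proof -
          have "(2 * s) powr (- (1/2)) = 1 / sqrt 2 * s powr (- (1/2))"
            using s by (simp add: powr_minus_half real_sqrt_mult)
          moreover have "s powr (a - 1/2 - 1) = s powr (a - 1) * s powr (- (1/2))"
            by (simp add: powr_add[symmetric])
          ultimately show ?thesis
            by (simp add: ennreal_mult'[symmetric] Gamma_one_half_real real_sqrt_divide mult_ac)
        qed
        finally show ?thesis using s by (simp add: ennreal_mult'[symmetric])
      qed (simp add: F_def)
    qed
  qed
  also have "\<dots> = ennreal (sqrt (pi / 2)) * ennreal (Gamma (a - 1/2))"
  proof -
    have "a - 1/2 > 0" using a by simp
    from nn_integral_Gamma_scaled[OF this zero_less_one]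
    have "ennreal (Gamma (a - 1/2)) = (\<integral>\<^sup>+s. ennreal (indicator {0..} s * s powr (a - 1/2 - 1) * exp (- 1 * s)) \<partial>lborel)"
      by simp
    then show ?thesis by (simp only:) (intro nn_integral_cmult, auto)
  qed
  finally have *: "ennreal (Gamma a) * (\<integral>\<^sup>+t. ennreal (indicator {0..} t * t powr (- 1/2) * (1 + 2 * t) powr (- a)) \<partial>lborel)
    = ennreal (sqrt (pi / 2) * Gamma (a - 1/2))" (is "_ * ?I = _")
    by (simp add: ennreal_mult')
  have "?I = ennreal (1 / Gamma a) * (ennreal (Gamma a) * ?I)"
    using Ga by (simp add: mult.assoc[symmetric] ennreal_mult'[symmetric])
  also have "\<dots> = ennreal (sqrt (pi / 2) * Gamma (a - 1/2) / Gamma a)"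
    unfolding * using Ga by (subst ennreal_mult'[symmetric]) auto
  finally show ?thesis .
qed

lemma sum_square_L2_set: "(L2_set x A)\<^sup>2 = (\<Sum>i\<in>A. (x i)\<^sup>2)"
  by (simp add: L2_set_def sum_nonneg)

lemma abs_coordinate_le_L2_set: "i < k \<Longrightarrow> \<bar>x i\<bar> \<le> L2_set x {..<k :: nat}"
proof -
  assume "i < k"
  then have "(x i)\<^sup>2 \<le> (\<Sum>i<k. (x i)\<^sup>2)" by (intro member_le_sum) auto
  then show ?thesis unfolding L2_set_def using real_le_rsqrt by force
qed

lemma measurable_L2_set_std_gaussian [measurable]:
  "(\<lambda>x. L2_set x {..<k}) \<in> borel_measurable (std_gaussian k)"
  unfolding L2_set_def by (intro measurable_compose[OF _ borel_measurable_sqrt] borel_measurable_sum borel_measurable_power) auto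

text \<open>The factor \<open>1 / |x|\<close> couples the coordinates; writing it as
  \<open>1 / sqrt pi\<close> times the integral of \<open>t powr (- 1/2) * exp (- t |x|\<^sup>2)\<close> over \<open>t > 0\<close> makes the
  integrand a product of functions of single coordinates. The same identity gives the mean norm
  \<open>rho k\<close> by summation over \<open>i\<close>.\<close>

lemma square_coordinate_over_norm:
  assumes i: "i < k"
  shows "has_bochner_integral (std_gaussian k) (\<lambda>x. (x i)\<^sup>2 / L2_set x {..<k}) (rho k / real k)"
proof -
  interpret finite_product_prob_space "\<lambda>_. std_normal" "{..<k}"
    by (rule finite_product_prob_space_std_normal) simp
  have sf: "pair_sigma_finite (std_gaussian k) lborel"
    by (intro pair_sigma_finite.intro prob_space_imp_sigma_finite prob_space_std_gaussian sigma_finite_lborel)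
  define h where "h t l y = ennreal ((if l = i then y\<^sup>2 else 1) * exp (- t * y\<^sup>2))" for t y and l :: nat
  define F where "F x t = ennreal (indicator {0..} t * t powr (- 1/2) / sqrt pi) * (\<Prod>l<k. h t l (x l))" for x t
  have k: "k > 0" using i by simp
  have hm: "(\<lambda>p. h (snd p) l (fst p l)) \<in> borel_measurable (std_gaussian k \<Otimes>\<^sub>M lborel)" if "l < k" for l
  proof -
    have *: "(\<lambda>p. ennreal ((if l = i then (x p)\<^sup>2 else 1) * exp (- y p * (x p)\<^sup>2))) \<in> borel_measurable M"
      if [measurable]: "x \<in> borel_measurable M" "y \<in> borel_measurable M"
      for x y :: "(nat \<Rightarrow> real) \<times> real \<Rightarrow> real" and M
      by measurable
    show ?thesis unfolding h_def
      by (intro * measurable_compose[OF measurable_fst measurable_coordinate_std_gaussian[OF that]])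
         (simp add: measurable_snd)
  qed
  have Fm: "case_prod F \<in> borel_measurable (std_gaussian k \<Otimes>\<^sub>M lborel)"
    unfolding F_def case_prod_unfold using hm
    by (intro borel_measurable_times_ennreal borel_measurable_prod_ennreal) auto
  have prod_h: "(\<Prod>l<k. h t l (x l)) = ennreal ((x i)\<^sup>2 * exp (- t * (L2_set x {..<k})\<^sup>2))" for t x
  proof -
    have "(\<Prod>l<k. h t l (x l)) = ennreal (\<Prod>l<k. (if l = i then (x i)\<^sup>2 else 1) * exp (- t * (x l)\<^sup>2))"
      unfolding h_def by (subst prod_ennreal) (auto intro!: arg_cong[of _ _ ennreal] prod.cong)
    also have "(\<Prod>l<k. (if l = i then (x i)\<^sup>2 else 1) * exp (- t * (x l)\<^sup>2)) = (x i)\<^sup>2 * exp (- t * (L2_set x {..<k})\<^sup>2)"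
      using i by (simp add: prod.distrib exp_sum[symmetric] sum_square_L2_set sum_distrib_left sum_negf)
    finally show ?thesis .
  qed
  have "(\<integral>\<^sup>+x. ennreal ((x i)\<^sup>2 / L2_set x {..<k}) \<partial>std_gaussian k) = (\<integral>\<^sup>+x. \<integral>\<^sup>+t. F x t \<partial>lborel \<partial>std_gaussian k)"
  proof (intro nn_integral_cong)
    fix x :: "nat \<Rightarrow> real"
    let ?r = "L2_set x {..<k}"
    have r0: "?r \<ge> 0" by (simp add: L2_set_def sum_nonneg)
    show "ennreal ((x i)\<^sup>2 / ?r) = (\<integral>\<^sup>+t. F x t \<partial>lborel)"
    proof (cases "?r = 0")
      case True
      then have "x i = 0" using abs_coordinate_le_L2_set[OF i, of x] by simp
      then show ?thesis by (simp add: F_def prod_h)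
    next
      case False
      with r0 have r: "?r > 0" by (simp add: less_le)
      have "(\<integral>\<^sup>+t. F x t \<partial>lborel) = (\<integral>\<^sup>+t. ennreal ((x i)\<^sup>2 / sqrt pi) *
          ennreal (indicator {0..} t * t powr (1/2 - 1) * exp (- ?r\<^sup>2 * t)) \<partial>lborel)"
        unfolding F_def prod_h
        by (intro nn_integral_cong) (simp add: ennreal_mult'[symmetric] mult_ac)
      also have "\<dots> = ennreal ((x i)\<^sup>2 / sqrt pi) * ennreal (Gamma (1/2) * ?r\<^sup>2 powr (- (1/2)))"
        unfolding nn_integral_Gamma_scaled[of "1/2" "?r\<^sup>2", OF half_gt_zero[OF zero_less_one] zero_less_power[OF r], symmetric]
        by (intro nn_integral_cmult) auto
      also have "\<dots> = ennreal ((x i)\<^sup>2 / ?r)"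
      proof -
        have "?r\<^sup>2 powr (- (1/2)) = 1 / ?r" using r by (simp add: powr_minus_half)
        moreover have "(x i)\<^sup>2 / sqrt pi * (sqrt pi * (1 / ?r)) = (x i)\<^sup>2 / ?r" by simp
        ultimately show ?thesis
          using r by (subst ennreal_mult'[symmetric]) (auto simp: Gamma_one_half_real)
      qed
      finally show ?thesis ..
    qed
  qed
  also have "\<dots> = (\<integral>\<^sup>+t. \<integral>\<^sup>+x. F x t \<partial>std_gaussian k \<partial>lborel)"
    using pair_sigma_finite.Fubini'[OF sf Fm] by simp
  also have "\<dots> = (\<integral>\<^sup>+t. ennreal (1 / sqrt pi) * ennreal (indicator {0..} t * t powr (- 1/2) * (1 + 2 * t) powr (- (real k / 2 + 1))) \<partial>lborel)"
  proof (intro nn_integral_cong)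
    fix t :: real
    have mh: "(\<lambda>x. \<Prod>l<k. h t l (x l)) \<in> borel_measurable (std_gaussian k)"
    proof (intro borel_measurable_prod_ennreal)
      fix l assume "l \<in> {..<k}"
      moreover have "h t l \<in> borel_measurable borel" unfolding h_def by measurable
      ultimately show "(\<lambda>x. h t l (x l)) \<in> borel_measurable (std_gaussian k)"
        by (intro measurable_compose[OF measurable_coordinate_std_gaussian]) auto
    qed
    have "(\<integral>\<^sup>+x. F x t \<partial>std_gaussian k) = ennreal (indicator {0..} t * t powr (- 1/2) / sqrt pi) * (\<integral>\<^sup>+x. (\<Prod>l<k. h t l (x l)) \<partial>std_gaussian k)"
      unfolding F_def by (intro nn_integral_cmult mh)
    also have "(\<integral>\<^sup>+x. (\<Prod>l<k. h t l (x l)) \<partial>std_gaussian k) = (\<Prod>l<k. \<integral>\<^sup>+y. h t l y \<partial>std_normal)"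
      unfolding std_gaussian_def by (intro product_nn_integral_prod) (auto simp: h_def)
    also have "ennreal (indicator {0..} t * t powr (- 1/2) / sqrt pi) * \<dots> =
       ennreal (1 / sqrt pi) * ennreal (indicator {0..} t * t powr (- 1/2) * (1 + 2 * t) powr (- (real k / 2 + 1)))"
    proof (cases "t \<ge> 0")
      case True
      have "(\<Prod>l<k. \<integral>\<^sup>+y. h t l y \<partial>std_normal) = (\<Prod>l<k. ennreal (if l = i then (1 + 2 * t) powr (- 3/2) else (1 + 2 * t) powr (- 1/2)))"
        using std_normal_Laplace_square[OF True] by (intro prod.cong) (auto simp: h_def)
      also have "\<dots> = ennreal (\<Prod>l<k. (if l = i then (1 + 2 * t) powr (- 1) else 1) * (1 + 2 * t) powr (- 1/2))"
      proof -
        have e: "(1 + 2 * t) powr (- 3/2) = (1 + 2 * t) powr (- 1) * (1 + 2 * t) powr (- 1/2)"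
          by (simp only: powr_add[symmetric]) simp
        show ?thesis unfolding e by (subst prod_ennreal) (auto intro!: arg_cong[of _ _ ennreal] prod.cong)
      qed
      also have "(\<Prod>l<k. (if l = i then (1 + 2 * t) powr (- 1) else 1) * (1 + 2 * t) powr (- 1/2)) = (1 + 2 * t) powr (- (real k / 2 + 1))"
      proof -
        have "(\<Prod>l<k. (if l = i then A else 1) * B) = A * B ^ k" for A B :: real
          using i by (simp add: prod.distrib)
        moreover have "((1 + 2 * t) powr (- 1/2)) ^ k = (1 + 2 * t) powr (- (real k / 2))"
          using True by (simp add: powr_power)
        moreover have "(1 + 2 * t) powr (- 1) * (1 + 2 * t) powr (- (real k / 2)) = (1 + 2 * t) powr (- (real k / 2 + 1))"
          by (simp only: powr_add[symmetric]) (simp add: algebra_simps)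
        ultimately show ?thesis by simp
      qed
      finally show ?thesis by (simp add: ennreal_mult'[symmetric] mult_ac)
    qed auto
    finally show "(\<integral>\<^sup>+x. F x t \<partial>std_gaussian k) = ennreal (1 / sqrt pi) * ennreal (indicator {0..} t * t powr (- 1/2) * (1 + 2 * t) powr (- (real k / 2 + 1)))" .
  qed
  also have "\<dots> = ennreal (1 / sqrt pi) * ennreal (sqrt (pi / 2) * Gamma (real k / 2 + 1 - 1/2) / Gamma (real k / 2 + 1))"
  proof -
    have "real k / 2 + 1 > 1/2" by simp
    note * = nn_integral_powr_half_Beta[OF this]
    show ?thesis unfolding *[symmetric] by (intro nn_integral_cmult) auto
  qed
  also have "\<dots> = ennreal (rho k / real k)"
  proof -
    have "Gamma (real k / 2 + 1) = real k / 2 * Gamma (real k / 2)"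
      using k by (intro Gamma_plus1) (auto dest: nonpos_Ints_nonpos)
    moreover have "real k / 2 + 1 - 1/2 = (real k + 1) / 2" by (simp add: field_simps)
    moreover have "Gamma (real k / 2) > 0" using k by (intro Gamma_real_pos) auto
    moreover have "1 / sqrt pi * (sqrt (pi / 2) * g1 / (real k / 2 * g)) = sqrt 2 * g1 / g / real k" if "g > 0" for g g1
    proof -
      have "sqrt (pi / 2) = sqrt pi * sqrt 2 / 2"
        by (simp add: real_sqrt_divide real_div_sqrt field_simps)
      then show ?thesis using that k by (simp add: field_simps)
    qed
    ultimately show ?thesis
      unfolding rho_def by (subst ennreal_mult'[symmetric]) (simp_all only: zero_le_divide_1_iff real_sqrt_ge_0_iff pi_ge_zero)
  qed
  finally have "(\<integral>\<^sup>+x. ennreal ((x i)\<^sup>2 / L2_set x {..<k}) \<partial>std_gaussian k) = ennreal (rho k / real k)" .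
  moreover have "0 \<le> rho k / real k"
    using k Gamma_real_pos[of "(real k + 1) / 2"] Gamma_real_pos[of "real k / 2"] by (simp add: rho_def)
  ultimately show ?thesis
    using i by (intro has_bochner_integral_nn_integral)
      (auto intro!: borel_measurable_divide borel_measurable_power AE_I2)
qed

lemma std_normal_odd_expectation:
  assumes [measurable]: "g \<in> borel_measurable borel" and odd: "\<And>y. g (- y) = - g y"
  shows "(\<integral>y. g y \<partial>std_normal) = (0 :: real)"
proof -
  have "(\<integral>y. std_normal_density y * g y \<partial>lborel) = - (\<integral>y. std_normal_density y * g y \<partial>lborel)"
    by (subst lborel_integral_real_affine[where c = "- 1" and t = 0])
       (simp_all add: odd normal_density_def)
  then show ?thesis by (subst integral_density) auto
qed

lemma std_gaussian_coordinate_moments: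
  assumes "i < n"
  shows "integrable (std_gaussian n) (\<lambda>x. x i)" "integrable (std_gaussian n) (\<lambda>x. \<bar>x i\<bar>)"
    "(\<integral>x. x i \<partial>std_gaussian n) = 0"
  by (rule std_gaussian_coordinate(1)[OF assms, THEN iffD2] std_gaussian_coordinate(2)[OF assms, THEN trans]
      std_normal_moments borel_measurable_abs measurable_ident_sets[OF refl] measurable_ident)+

text \<open>The integrand is odd in the coordinate \<open>x i\<close>, so integrating this coordinate first gives zero.\<close>

lemma mixed_coordinates_over_norm:
  assumes "i < k" "l < k" "i \<noteq> l"
  shows "has_bochner_integral (std_gaussian k) (\<lambda>x. x i * x l / L2_set x {..<k}) 0"
proof -
  let ?f = "\<lambda>x. x i * x l / L2_set x {..<k}"
  have fm: "?f \<in> borel_measurable (std_gaussian k)"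
    by (rule borel_measurable_divide[OF borel_measurable_times[OF
        measurable_coordinate_std_gaussian[OF assms(1)] measurable_coordinate_std_gaussian[OF assms(2)]]
        measurable_L2_set_std_gaussian])
  have "integrable (std_gaussian k) (\<lambda>x. x i)"
    by (rule std_gaussian_coordinate_moments[OF assms(1)])
  then have int: "integrable (std_gaussian k) ?f"
  proof (rule Bochner_Integration.integrable_bound[OF _ fm])
    show "AE x in std_gaussian k. norm (?f x) \<le> norm (x i)"
    proof (intro AE_I2)
      fix x :: "nat \<Rightarrow> real"
      have "\<bar>x l\<bar> \<le> \<bar>L2_set x {..<k}\<bar>" using abs_coordinate_le_L2_set[OF assms(2), of x] by linarith
      then have "\<bar>x l\<bar> / \<bar>L2_set x {..<k}\<bar> \<le> \<bar>L2_set x {..<k}\<bar> / \<bar>L2_set x {..<k}\<bar>"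
        by (rule divide_right_mono) simp
      also have "\<dots> \<le> 1" by simp
      finally have "\<bar>x i\<bar> * (\<bar>x l\<bar> / \<bar>L2_set x {..<k}\<bar>) \<le> \<bar>x i\<bar> * 1"
        by (intro mult_left_mono) simp_all
      then show "norm (?f x) \<le> norm (x i)" by (simp add: abs_mult)
    qed
  qed
  interpret S: finite_product_prob_space "\<lambda>_. std_normal" "{..<k}"
    by (rule finite_product_prob_space_std_normal) simp
  have ins: "insert i ({..<k} - {i}) = {..<k}" using assms by auto
  have "integrable (Pi\<^sub>M (insert i ({..<k} - {i})) (\<lambda>_. std_normal)) ?f"
    using int unfolding ins std_gaussian_def .
  from S.product_integral_insert[OF _ _ this]
  have "(\<integral>x. ?f x \<partial>std_gaussian k) = (\<integral>x. (\<integral>y. ?f (x(i := y)) \<partial>std_normal) \<partial>(\<Pi>\<^sub>M _\<in>{..<k} - {i}. std_normal))"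
    unfolding ins std_gaussian_def by simp
  also have "\<dots> = (\<integral>x. 0 \<partial>(\<Pi>\<^sub>M _\<in>{..<k} - {i}. std_normal))"
  proof (intro Bochner_Integration.integral_cong refl std_normal_odd_expectation)
    fix x :: "nat \<Rightarrow> real"
    show "(\<lambda>y. ?f (x(i := y))) \<in> borel_measurable borel"
      unfolding L2_set_def fun_upd_def by measurable
    have "L2_set (x(i := - y)) {..<k} = L2_set (x(i := y)) {..<k}" for y
      unfolding L2_set_def by (intro arg_cong[of _ _ sqrt] sum.cong) auto
    then show "?f (x(i := - y)) = - ?f (x(i := y))" for y using assms by simp
  qed
  also have "\<dots> = 0" by simp
  finally show ?thesis using int by (simp add: has_bochner_integral_iff)
qed

lemma matrix_form_over_norm:
  shows "has_bochner_integral (std_gaussian k)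
    (\<lambda>x. (\<Sum>j<m. (\<Sum>i<k. x i * X (i, j)) * (\<Sum>i<k. x i * Y (i, j))) / L2_set x {..<k})
    (rho k / real k * mat_inner k m X Y)"
proof -
  have 0: "has_bochner_integral (std_gaussian k) (\<lambda>x. x i * x l / L2_set x {..<k}) (if i = l then rho k / real k else 0)"
    if "i < k" "l < k" for i l
    using square_coordinate_over_norm[OF that(1)] mixed_coordinates_over_norm[OF that]
    by (cases "i = l") (simp_all add: power2_eq_square)
  have 1: "has_bochner_integral (std_gaussian k)
     (\<lambda>x. \<Sum>j<m. \<Sum>i<k. \<Sum>l<k. X (i, j) * Y (l, j) * (x i * x l / L2_set x {..<k}))
     (\<Sum>j<m. \<Sum>i<k. \<Sum>l<k. X (i, j) * Y (l, j) * (if i = l then rho k / real k else 0))"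
    by (intro has_bochner_integral_sum has_bochner_integral_mult_right 0) auto
  have 2: "(\<Sum>j<m. \<Sum>i<k. \<Sum>l<k. X (i, j) * Y (l, j) * (x i * x l / L2_set x {..<k}))
      = (\<Sum>j<m. (\<Sum>i<k. x i * X (i, j)) * (\<Sum>i<k. x i * Y (i, j))) / L2_set x {..<k}" for x
    unfolding sum_product sum_divide_distrib by (intro sum.cong refl) simp
  have 3: "(\<Sum>j<m. \<Sum>i<k. \<Sum>l<k. X (i, j) * Y (l, j) * (if i = l then rho k / real k else 0))
      = rho k / real k * mat_inner k m X Y"
    by (simp add: mat_inner_def sum_distrib_left mult_ac if_distrib sum.If_cases cong: if_cong)
  show ?thesis using 1 unfolding 2 3 .
qed

lemma gram_form_over_norm:
  "has_bochner_integral (std_gaussian k) (\<lambda>x. gram_form k m X x / L2_set x {..<k})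
    (rho k / real k * (frob_norm k m X)\<^sup>2)"
  using matrix_form_over_norm[where X = X and Y = X]
  by (simp add: gram_form_def mat_inner_self power2_eq_square)

lemma expectation_norm:
  assumes "k > 0"
  shows "has_bochner_integral (std_gaussian k) (\<lambda>x. L2_set x {..<k}) (rho k)"
proof -
  have "has_bochner_integral (std_gaussian k) (\<lambda>x. \<Sum>i<k. (x i)\<^sup>2 / L2_set x {..<k}) (\<Sum>i<k. rho k / real k)"
    using square_coordinate_over_norm by (intro has_bochner_integral_sum) auto
  moreover have "(\<Sum>i<k. (x i)\<^sup>2 / L2_set x {..<k}) = L2_set x {..<k}" for x
  proof -
    have "(\<Sum>i<k. (x i)\<^sup>2 / L2_set x {..<k}) = (L2_set x {..<k})\<^sup>2 / L2_set x {..<k}"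
      unfolding sum_square_L2_set by (rule sum_divide_distrib[symmetric])
    then show ?thesis by (simp add: power2_eq_square)
  qed
  ultimately show ?thesis using assms by simp
qed

text \<open>The arithmetic-geometric mean inequality for \<open>|X\<^sup>T x|\<close>, written as the geometric mean of
  \<open>c |X\<^sup>T x|\<^sup>2 / |x|\<close> and \<open>|x| / c\<close>. Its right-hand side has an explicit expectation, and optimising
  \<open>c\<close> afterwards recovers the Cauchy-Schwarz bound.\<close>

lemma sqrt_gram_form_le:
  assumes "c > 0"
  shows "sqrt (gram_form k m X x) \<le> (c * (gram_form k m X x / L2_set x {..<k}) + L2_set x {..<k} / c) / 2"
proof (cases "L2_set x {..<k} = 0")
  case True
  then have "x i = 0" if "i < k" for i using abs_coordinate_le_L2_set[OF that, of x] by simp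
  then have "gram_form k m X x = 0" by (simp add: gram_form_def)
  then show ?thesis using True by simp
next
  case False
  define r where "r = L2_set x {..<k}"
  define s where "s = sqrt (gram_form k m X x)"
  have r: "r > 0" using False by (simp add: r_def less_le)
  have "0 \<le> (c * s - r)\<^sup>2 / (c * r)" using assms r by simp
  also have "\<dots> = c * (s\<^sup>2 / r) + r / c - 2 * s"
  proof -
    have "(c * s - r)\<^sup>2 / (c * r) = (c * s)\<^sup>2 / (c * r) + r\<^sup>2 / (c * r) - 2 * (c * s) * r / (c * r)"
      unfolding power2_diff add_divide_distrib diff_divide_distrib by simp
    also have "(c * s)\<^sup>2 / (c * r) = c * (s\<^sup>2 / r)" using assms by (simp add: power2_eq_square)
    also have "r\<^sup>2 / (c * r) = r / c" using r by (simp add: power2_eq_square)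
    also have "2 * (c * s) * r / (c * r) = 2 * s" using assms r by simp
    finally show ?thesis .
  qed
  finally show ?thesis by (simp add: r_def s_def)
qed

lemma measurable_gram_form [measurable]: "gram_form k m X \<in> borel_measurable (std_gaussian k)"
  unfolding gram_form_def[abs_def]
  by (intro borel_measurable_sum borel_measurable_power borel_measurable_times) auto

lemma integrable_sqrt_gram_form:
  assumes "k > 0"
  shows "integrable (std_gaussian k) (\<lambda>x. sqrt (gram_form k m X x))"
proof (rule Bochner_Integration.integrable_bound)
  show "integrable (std_gaussian k) (\<lambda>x. (1 * (gram_form k m X x / L2_set x {..<k}) + L2_set x {..<k} / 1) / 2)"
    using gram_form_over_norm[of k m X] expectation_norm[OF assms]
    by (intro integrable_divide Bochner_Integration.integrable_add integrable_mult_right) (auto dest: integrable.intros)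
  show "AE x in std_gaussian k. norm (sqrt (gram_form k m X x))
      \<le> norm ((1 * (gram_form k m X x / L2_set x {..<k}) + L2_set x {..<k} / 1) / 2)"
  proof (intro AE_I2)
    fix x
    show "norm (sqrt (gram_form k m X x))
      \<le> norm ((1 * (gram_form k m X x / L2_set x {..<k}) + L2_set x {..<k} / 1) / 2)"
      using sqrt_gram_form_le[OF zero_less_one, of k m X x] by (simp add: abs_le_iff)
  qed
qed measurable

section \<open>The support function of the Segre zonoid\<close>

lemma mat_inner_outer_prod:
  "mat_inner k m X (outer_prod k m x y) = (\<Sum>j<m. \<Sum>i<k. X (i, j) * (x i * y j))"
  by (auto simp: mat_inner_def outer_prod_def mat_idx_def intro!: sum.cong)

lemma outer_prod_moments:
  assumes "i < k" "j < m"
  shows "integrable (std_gaussian k \<Otimes>\<^sub>M std_gaussian m) (\<lambda>p. fst p i * snd p j)"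
    and "(\<integral>p. fst p i * snd p j \<partial>(std_gaussian k \<Otimes>\<^sub>M std_gaussian m)) = 0"
proof -
  interpret P: pair_sigma_finite "std_gaussian k" "std_gaussian m"
    by (intro pair_sigma_finite.intro prob_space_imp_sigma_finite prob_space_std_gaussian)
  have m: "(\<lambda>p. fst p i * snd p j) \<in> borel_measurable (std_gaussian k \<Otimes>\<^sub>M std_gaussian m)"
    by (rule borel_measurable_times[OF
        measurable_compose[OF measurable_fst measurable_coordinate_std_gaussian[OF assms(1)]]
        measurable_compose[OF measurable_snd measurable_coordinate_std_gaussian[OF assms(2)]]])
  show int: "integrable (std_gaussian k \<Otimes>\<^sub>M std_gaussian m) (\<lambda>p. fst p i * snd p j)"
  proof (rule P.Fubini_integrable[OF m])
    show "integrable (std_gaussian k) (\<lambda>x. \<integral>y. norm (fst (x, y) i * snd (x, y) j) \<partial>std_gaussian m)"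
      using std_gaussian_coordinate_moments[OF assms(1)] by (simp add: abs_mult)
    show "AE x in std_gaussian k. integrable (std_gaussian m) (\<lambda>y. fst (x, y) i * snd (x, y) j)"
      using std_gaussian_coordinate_moments[OF assms(2)] by simp
  qed
  show "(\<integral>p. fst p i * snd p j \<partial>(std_gaussian k \<Otimes>\<^sub>M std_gaussian m)) = 0"
    using P.integral_fst'[OF int] std_gaussian_coordinate_moments(3)[OF assms(2)] by simp
qed

lemma inner_outer_prod_moments:
  shows "integrable (std_gaussian k \<Otimes>\<^sub>M std_gaussian m) (\<lambda>p. mat_inner k m X (outer_prod k m (fst p) (snd p)))"
    and "(\<integral>p. mat_inner k m X (outer_prod k m (fst p) (snd p)) \<partial>(std_gaussian k \<Otimes>\<^sub>M std_gaussian m)) = 0"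
proof -
  have *: "has_bochner_integral (std_gaussian k \<Otimes>\<^sub>M std_gaussian m)
      (\<lambda>p. \<Sum>j<m. \<Sum>i<k. X (i, j) * (fst p i * snd p j)) (\<Sum>j<m. \<Sum>i<k. X (i, j) * 0)"
    using outer_prod_moments
    by (intro has_bochner_integral_sum has_bochner_integral_mult_right) (auto simp: has_bochner_integral_iff)
  then show "integrable (std_gaussian k \<Otimes>\<^sub>M std_gaussian m) (\<lambda>p. mat_inner k m X (outer_prod k m (fst p) (snd p)))"
    "(\<integral>p. mat_inner k m X (outer_prod k m (fst p) (snd p)) \<partial>(std_gaussian k \<Otimes>\<^sub>M std_gaussian m)) = 0"
    by (auto simp: mat_inner_outer_prod has_bochner_integral_iff)
qed

text \<open>For fixed \<open>x\<close> the pairing of \<open>X\<close> with the outer product is a linear form in \<open>y\<close> with coefficient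
  vector \<open>X\<^sup>T x\<close>.\<close>

lemma segre_support_eq:
  "segre_support k m X = 1 / sqrt (2 * pi) * (\<integral>x. sqrt (gram_form k m X x) \<partial>std_gaussian k)"
proof -
  interpret P: pair_sigma_finite "std_gaussian k" "std_gaussian m"
    by (intro pair_sigma_finite.intro prob_space_imp_sigma_finite prob_space_std_gaussian)
  let ?f = "\<lambda>p. \<bar>mat_inner k m X (outer_prod k m (fst p) (snd p))\<bar>"
  have int: "integrable (std_gaussian k \<Otimes>\<^sub>M std_gaussian m) ?f"
    by (intro integrable_abs inner_outer_prod_moments)
  have "segre_support k m X = 1 / 2 * (\<integral>x. \<integral>y. ?f (x, y) \<partial>std_gaussian m \<partial>std_gaussian k)"
    unfolding P.integral_fst'[OF int] by (simp add: segre_support_def case_prod_unfold)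
  also have "(\<lambda>x. \<integral>y. ?f (x, y) \<partial>std_gaussian m) = (\<lambda>x. sqrt (2 / pi) * sqrt (gram_form k m X x))"
  proof
    fix x
    have "?f (x, y) = \<bar>\<Sum>j<m. (\<Sum>i<k. x i * X (i, j)) * y j\<bar>" for y
      by (simp add: mat_inner_outer_prod sum_distrib_left sum_distrib_right mult_ac)
    then show "(\<integral>y. ?f (x, y) \<partial>std_gaussian m) = sqrt (2 / pi) * sqrt (gram_form k m X x)"
      by (simp add: std_gaussian_expectation_abs_linear gram_form_def)
  qed
  also have "1 / 2 * (\<integral>x. sqrt (2 / pi) * sqrt (gram_form k m X x) \<partial>std_gaussian k)
      = 1 / sqrt (2 * pi) * (\<integral>x. sqrt (gram_form k m X x) \<partial>std_gaussian k)"
    by (simp add: real_sqrt_divide real_sqrt_mult real_divide_square_eq field_simps)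
  finally show ?thesis .
qed

text \<open>The subgradient of the support function at \<open>X\<close> is the expectation of \<open>x y\<^sup>T\<close> over the event
  that \<open>X\<close> pairs positively with it. Since the pairing has mean zero, half its mean absolute
  value is the mean of its positive part, and restricting a random variable to an event never exceeds its
  positive part.\<close>

lemma segre_support_attained:
  obtains Y where "Y \<in> mats k m" "mat_inner k m X Y = segre_support k m X"
    "\<And>Z. mat_inner k m Z Y \<le> segre_support k m Z"
proof -
  let ?M = "std_gaussian k \<Otimes>\<^sub>M std_gaussian m"
  let ?s = "\<lambda>Z p. mat_inner k m Z (outer_prod k m (fst p) (snd p))"
  let ?i = "\<lambda>p. if ?s X p > 0 then 1 else 0 :: real"
  define Y where "Y = (\<lambda>(i, j)\<in>mat_idx k m. \<integral>p. ?i p * (fst p i * snd p j) \<partial>?M)"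
  have [measurable]: "?s Z \<in> borel_measurable ?M" for Z
    using inner_outer_prod_moments(1) by (rule borel_measurable_integrable)
  have im: "?i \<in> borel_measurable ?M" by measurable
  have int: "integrable ?M (\<lambda>p. ?i p * f p)" if "integrable ?M f" for f :: "_ \<Rightarrow> real"
    using that by (rule Bochner_Integration.integrable_bound)
      (auto intro!: borel_measurable_times im borel_measurable_integrable[OF that])
  have inner: "mat_inner k m Z Y = (\<integral>p. ?i p * ?s Z p \<partial>?M)" for Z
  proof -
    have "has_bochner_integral ?M (\<lambda>p. \<Sum>j<m. \<Sum>i<k. Z (i, j) * (?i p * (fst p i * snd p j)))
      (\<Sum>j<m. \<Sum>i<k. Z (i, j) * Y (i, j))"
      using int[OF outer_prod_moments(1)]
      by (intro has_bochner_integral_sum has_bochner_integral_mult_right)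
         (auto simp: has_bochner_integral_iff Y_def mat_idx_def)
    moreover have "(\<Sum>j<m. \<Sum>i<k. Z (i, j) * (?i p * (fst p i * snd p j))) = ?i p * ?s Z p" for p
      unfolding mat_inner_outer_prod sum_distrib_left by (simp add: mult_ac)
    ultimately show ?thesis unfolding mat_inner_def[of k m Z Y] by (simp only: has_bochner_integral_iff)
  qed
  have half: "segre_support k m Z = (\<integral>p. (\<bar>?s Z p\<bar> + ?s Z p) / 2 \<partial>?M)" for Z
    using inner_outer_prod_moments[of k m Z]
    by (simp add: segre_support_def case_prod_unfold Bochner_Integration.integral_add integrable_abs)
  show ?thesis
  proof
    show "Y \<in> mats k m" by (auto simp: Y_def mats_def)
    have "?i p * ?s X p = (\<bar>?s X p\<bar> + ?s X p) / 2" for p by auto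
    then show "mat_inner k m X Y = segre_support k m X" 
      unfolding inner half by (rule Bochner_Integration.integral_cong[OF refl])
    fix Z
    show "mat_inner k m Z Y \<le> segre_support k m Z"
      unfolding inner half using inner_outer_prod_moments(1)[of k m Z]
      by (intro integral_mono int integrable_divide Bochner_Integration.integrable_add integrable_abs) auto
  qed
qed

section \<open>The Segre zonoid between two balls\<close>

text \<open>The intersection of the half-spaces prescribed by the support function. It is the zonoid once every
  one of these half-spaces is known to touch it.\<close>

definition segre_body :: "nat \<Rightarrow> nat \<Rightarrow> (nat \<times> nat \<Rightarrow> real) set" where
  "segre_body k m = {Y \<in> mats k m. \<forall>X\<in>mats k m. mat_inner k m X Y \<le> segre_support k m X}"

lemma rho_pos: "k > 0 \<Longrightarrow> rho k > 0"
  using Gamma_real_pos[of "(real k + 1) / 2"] Gamma_real_pos[of "real k / 2"] by (simp add: rho_def)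

text \<open>Equality holds when all singular values of \<open>X\<close> are equal; the radius of \<open>segre_ball\<close> is the constant
  in this bound.\<close>

lemma segre_support_le_frob_norm:
  assumes k: "k > 0"
  shows "segre_support k m X \<le> 1 / sqrt (2 * pi) * (rho k / sqrt (real k)) * frob_norm k m X"
proof (cases "frob_norm k m X = 0")
  case True
  then have "X p = 0" if "p \<in> mat_idx k m" for p using entry_le_frob_norm[OF that, of X] by simp
  then have "gram_form k m X x = 0" for x by (simp add: gram_form_def mat_idx_def)
  then show ?thesis using True by (simp add: segre_support_eq)
next
  case False
  define F where "F = frob_norm k m X"
  have F: "F > 0" using False by (simp add: F_def less_le frob_norm_def mat_inner_def sum_nonneg)
  \<comment> \<open>This choice balances the two summands of the arithmetic-geometric mean bound.\<close>
  define c where "c = sqrt (real k) / F"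
  have c: "c > 0" using F k by (simp add: c_def)
  have *: "has_bochner_integral (std_gaussian k)
      (\<lambda>x. (c * (gram_form k m X x / L2_set x {..<k}) + L2_set x {..<k} / c) / 2)
      ((c * (rho k / real k * F\<^sup>2) + rho k / c) / 2)"
    unfolding F_def using gram_form_over_norm[of k m X] expectation_norm[OF k]
    by (intro has_bochner_integral_divide has_bochner_integral_add has_bochner_integral_mult_right) auto
  have "(\<integral>x. sqrt (gram_form k m X x) \<partial>std_gaussian k)
      \<le> (\<integral>x. (c * (gram_form k m X x / L2_set x {..<k}) + L2_set x {..<k} / c) / 2 \<partial>std_gaussian k)"
    using * by (intro integral_mono integrable_sqrt_gram_form k sqrt_gram_form_le c)
      (simp add: has_bochner_integral_iff)
  also have "\<dots> = (c * (rho k / real k * F\<^sup>2) + rho k / c) / 2"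
    using * by (rule has_bochner_integral_integral_eq)
  also have "\<dots> = rho k / sqrt (real k) * F"
  proof -
    have "real k = sqrt (real k) * sqrt (real k)" by simp
    then have "c * (rho k / real k * F\<^sup>2) = rho k / sqrt (real k) * F"
      using F k by (simp add: c_def power2_eq_square field_simps)
    moreover have "rho k / c = rho k / sqrt (real k) * F" by (simp add: c_def)
    ultimately show ?thesis by simp
  qed
  finally have "1 / sqrt (2 * pi) * (\<integral>x. sqrt (gram_form k m X x) \<partial>std_gaussian k)
      \<le> 1 / sqrt (2 * pi) * (rho k / sqrt (real k) * F)"
    by (intro mult_left_mono) auto
  then show ?thesis by (simp only: segre_support_eq F_def mult.assoc)
qed

text \<open>Each member \<open>Y\<close> is tested against \<open>X = Y\<close>.\<close>

lemma segre_body_subset_ball: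
  assumes k: "k > 0"
  shows "segre_body k m \<subseteq> segre_ball k m"
proof
  fix Y assume Y: "Y \<in> segre_body k m"
  let ?R = "1 / sqrt (2 * pi) * (rho k / sqrt (real k))"
  have "frob_norm k m Y * frob_norm k m Y = mat_inner k m Y Y"
    by (simp add: mat_inner_self power2_eq_square)
  also have "\<dots> \<le> segre_support k m Y" using Y by (auto simp: segre_body_def)
  also have "\<dots> \<le> ?R * frob_norm k m Y" by (rule segre_support_le_frob_norm[OF k])
  finally have *: "frob_norm k m Y * frob_norm k m Y \<le> ?R * frob_norm k m Y" .
  have "frob_norm k m Y \<le> ?R"
  proof (cases "frob_norm k m Y > 0")
    case True
    with * show ?thesis by (simp only: mult_le_cancel_right)
  next
    case False
    have "0 \<le> ?R" using rho_pos[OF k] by simp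
    with False show ?thesis by (meson dual_order.trans linorder_not_less)
  qed
  then show "Y \<in> segre_ball k m" using Y by (simp add: segre_ball_def segre_body_def)
qed

lemma convex_body_segre_body:
  assumes k: "k > 0"
  shows "convex_body k m (segre_body k m)"
  unfolding convex_body_def
proof (intro conjI)
  show "segre_body k m \<subseteq> mats k m" by (auto simp: segre_body_def)
  show "segre_body k m \<noteq> {}"
    by (rule segre_support_attained[of k m undefined]) (auto simp: segre_body_def)
  let ?R = "1 / sqrt (2 * pi) * (rho k / sqrt (real k))"
  have "segre_body k m = mats k m \<inter> (\<Inter>X\<in>mats k m. {Y. mat_inner k m X Y \<le> segre_support k m X})"
    by (auto simp: segre_body_def)
  moreover have "closed {Y. mat_inner k m X Y \<le> segre_support k m X}" for X
    by (intro closed_Collect_le continuous_on_mat_inner continuous_on_const continuous_on_id)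
  ultimately have "closed (segre_body k m)" by (simp only:) (intro closed_Int closed_INT ballI closed_mats)
  moreover have "segre_body k m \<subseteq> {X \<in> mats k m. \<forall>p\<in>mat_idx k m. \<bar>X p\<bar> \<le> ?R}"
  proof
    fix X assume "X \<in> segre_body k m"
    then have "X \<in> mats k m" "frob_norm k m X \<le> ?R"
      using segre_body_subset_ball[OF k, of m] by (auto simp: segre_ball_def)
    then show "X \<in> {X \<in> mats k m. \<forall>p\<in>mat_idx k m. \<bar>X p\<bar> \<le> ?R}"
      by (auto intro: order_trans[OF entry_le_frob_norm])
  qed
  ultimately show "compact (segre_body k m)"
    using closed_Int_compact[OF _ compact_mat_box[of k m ?R], of "segre_body k m"] by (simp only: Int_absorb2)
  show "mat_convex k m (segre_body k m)"
    unfolding mat_convex_def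
  proof (intro ballI)
    fix Y Z t assume YZ: "Y \<in> segre_body k m" "Z \<in> segre_body k m" and t: "t \<in> {0..1::real}"
    have "mat_inner k m X (\<lambda>p\<in>mat_idx k m. (1 - t) * Y p + t * Z p) \<le> segre_support k m X"
      if X: "X \<in> mats k m" for X
    proof -
      have "mat_inner k m X (\<lambda>p\<in>mat_idx k m. (1 - t) * Y p + t * Z p)
          = (1 - t) * mat_inner k m X Y + t * mat_inner k m X Z"
        by (simp add: mat_inner_alt sum_distrib_left sum.distrib[symmetric] algebra_simps)
      also have "\<dots> \<le> (1 - t) * segre_support k m X + t * segre_support k m X"
        using YZ X t by (intro add_mono mult_left_mono) (auto simp: segre_body_def)
      finally show ?thesis by (simp add: algebra_simps)
    qed
    then show "(\<lambda>p\<in>mat_idx k m. (1 - t) * Y p + t * Z p) \<in> segre_body k m"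
      by (auto simp: segre_body_def mats_def)
  qed
qed

lemma support_function_segre_body:
  assumes "X \<in> mats k m"
  shows "support_function k m (segre_body k m) X = segre_support k m X"
proof -
  obtain Y where Y: "Y \<in> mats k m" "mat_inner k m X Y = segre_support k m X"
    "\<And>Z. mat_inner k m Z Y \<le> segre_support k m Z"
    using segre_support_attained by blast
  then have "Y \<in> segre_body k m" by (simp add: segre_body_def)
  with Y(2) have "segre_support k m X \<in> mat_inner k m X ` segre_body k m" by (metis imageI)
  moreover have "z \<le> segre_support k m X" if "z \<in> mat_inner k m X ` segre_body k m" for z
    using that assms by (auto simp: segre_body_def)
  ultimately show ?thesis unfolding support_function_def by (rule cSup_eq_maximum)
qed

lemma segre_zonoid_eq:
  assumes "k > 0"
  shows "segre_zonoid k m = segre_body k m"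
  unfolding segre_zonoid_def
proof (rule the_equality)
  show "convex_body k m (segre_body k m) \<and>
    (\<forall>X\<in>mats k m. support_function k m (segre_body k m) X = segre_support k m X)"
    using convex_body_segre_body[OF assms] support_function_segre_body by auto
  show "K = segre_body k m" if "convex_body k m K \<and> (\<forall>X\<in>mats k m. support_function k m K X = segre_support k m X)" for K
    using that convex_body_segre_body[OF assms] support_function_segre_body
    by (intro support_function_eqD) auto
qed

text \<open>The gram form bounds \<open>|X\<^sup>T u|\<close> by \<open>r |u|\<close>, so for \<open>r \<ge> 0\<close> this is the ball of radius \<open>r\<close> in the
  operator norm.\<close>

definition spectral_ball :: "nat \<Rightarrow> nat \<Rightarrow> real \<Rightarrow> (nat \<times> nat \<Rightarrow> real) set" where
  "spectral_ball k m r = {X \<in> mats k m. \<forall>u. gram_form k m X u \<le> r\<^sup>2 * (\<Sum>i<k. (u i)\<^sup>2)}"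

text \<open>The inner product of \<open>X\<close> and \<open>Y\<close> is, up to the factor \<open>rho k / k\<close>, the mean of
  \<open>(X\<^sup>T x) \<bullet> (Y\<^sup>T x) / |x|\<close>, and \<open>|Y\<^sup>T x| \<le> r |x|\<close>.\<close>

lemma spectral_ball_subset_segre_body:
  assumes k: "k > 0"
  shows "spectral_ball k m (rho k / (real k * sqrt (2 * pi))) \<subseteq> segre_body k m"
proof
  define r where "r = rho k / (real k * sqrt (2 * pi))"
  have r: "r > 0" using rho_pos[OF k] k by (simp add: r_def)
  fix Y assume "Y \<in> spectral_ball k m (rho k / (real k * sqrt (2 * pi)))"
  then have Y: "Y \<in> mats k m" "\<And>u. gram_form k m Y u \<le> r\<^sup>2 * (\<Sum>i<k. (u i)\<^sup>2)"
    by (auto simp: spectral_ball_def r_def)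
  have "mat_inner k m X Y \<le> segre_support k m X" for X
  proof -
    let ?I = "\<lambda>x. (\<Sum>j<m. (\<Sum>i<k. x i * X (i, j)) * (\<Sum>i<k. x i * Y (i, j))) / L2_set x {..<k}"
    note I = matrix_form_over_norm[where k = k and m = m and X = X and Y = Y]
    have "rho k / real k * mat_inner k m X Y = (\<integral>x. ?I x \<partial>std_gaussian k)"
      using I by (rule has_bochner_integral_integral_eq[symmetric])
    also have "\<dots> \<le> (\<integral>x. r * sqrt (gram_form k m X x) \<partial>std_gaussian k)"
    proof (intro integral_mono integrable_mult_right integrable_sqrt_gram_form k)
      show "integrable (std_gaussian k) ?I" using I by (simp add: has_bochner_integral_iff)
      fix x
      show "?I x \<le> r * sqrt (gram_form k m X x)"
      proof (cases "L2_set x {..<k} = 0")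
        case True
        then show ?thesis using r by simp
      next
        case False
        then have pos: "L2_set x {..<k} > 0" by (simp add: less_le)
        have "(\<Sum>j<m. (\<Sum>i<k. x i * X (i, j)) * (\<Sum>i<k. x i * Y (i, j)))
            \<le> (\<Sum>j<m. \<bar>\<Sum>i<k. x i * X (i, j)\<bar> * \<bar>\<Sum>i<k. x i * Y (i, j)\<bar>)"
          by (intro sum_mono) (simp add: abs_mult[symmetric])
        also have "\<dots> \<le> sqrt (gram_form k m X x) * sqrt (gram_form k m Y x)"
          unfolding gram_form_def L2_set_def[symmetric] by (rule L2_set_mult_ineq)
        also have "\<dots> \<le> sqrt (gram_form k m X x) * sqrt (r\<^sup>2 * (\<Sum>i<k. (x i)\<^sup>2))"
          using Y(2) by (intro mult_left_mono real_sqrt_le_mono) auto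
        also have "sqrt (r\<^sup>2 * (\<Sum>i<k. (x i)\<^sup>2)) = r * L2_set x {..<k}"
          using r by (simp add: real_sqrt_mult L2_set_def)
        finally show ?thesis using pos by (simp add: field_simps)
      qed
    qed
    also have "\<dots> = rho k / real k * segre_support k m X"
      by (simp add: segre_support_eq r_def)
    finally show ?thesis using rho_pos[OF k] k by (simp add: divide_le_cancel)
  qed
  then show "Y \<in> segre_body k m" using Y(1) by (simp add: segre_body_def)
qed

section \<open>Triangular factorisation\<close>

text \<open>Completing the square in the first variable leaves a positive definite form in the others,
  the Schur complement. The factor is lower triangular, and the form at \<open>u\<close> is \<open>|L\<^sup>T u|\<^sup>2\<close>.\<close>

lemma Cholesky_factorisation:
  fixes A :: "nat \<Rightarrow> nat \<Rightarrow> real"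
  assumes "\<And>i j. i < k \<Longrightarrow> j < k \<Longrightarrow> A i j = A j i"
    and "\<And>u. \<exists>i<k. u i \<noteq> 0 \<Longrightarrow> (\<Sum>i<k. \<Sum>j<k. A i j * u i * u j) > 0"
  shows "\<exists>L. (\<forall>l<k. L l l > 0) \<and> (\<forall>i l. i < l \<longrightarrow> L i l = 0) \<and>
    (\<forall>u. (\<Sum>i<k. \<Sum>j<k. A i j * u i * u j) = (\<Sum>l<k. (\<Sum>i<k. u i * L i l)\<^sup>2))"
  using assms
proof (induction k arbitrary: A)
  case 0
  show ?case by (intro exI[of _ "\<lambda>i l. if i = l then 1 else 0"]) auto
next
  case (Suc k)
  define a where "a = A 0 0"
  have "a = (\<Sum>i<Suc k. \<Sum>j<Suc k. A i j * (if i = 0 then 1 else 0) * (if j = 0 then 1 else 0))"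
    by (simp add: sum.lessThan_Suc_shift a_def del: sum.lessThan_Suc)
  also have "\<dots> > 0" by (rule Suc.prems(2)) auto
  finally have a: "a > 0" .
  define c where "c i = A (Suc i) 0 / sqrt a" for i
  define A' where "A' i j = A (Suc i) (Suc j) - c i * c j" for i j
  have split: "(\<Sum>i<Suc k. \<Sum>j<Suc k. A i j * u i * u j)
      = (sqrt a * u 0 + (\<Sum>i<k. u (Suc i) * c i))\<^sup>2 + (\<Sum>i<k. \<Sum>j<k. A' i j * u (Suc i) * u (Suc j))" for u
  proof -
    have "(\<Sum>i<Suc k. \<Sum>j<Suc k. A i j * u i * u j)
      = a * (u 0)\<^sup>2 + (\<Sum>j<k. A 0 (Suc j) * u 0 * u (Suc j)) + (\<Sum>i<k. A (Suc i) 0 * u (Suc i) * u 0)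
         + (\<Sum>i<k. \<Sum>j<k. A (Suc i) (Suc j) * u (Suc i) * u (Suc j))"
      by (simp add: sum.lessThan_Suc_shift a_def sum.distrib power2_eq_square del: sum.lessThan_Suc)
    also have "(\<Sum>j<k. A 0 (Suc j) * u 0 * u (Suc j)) = (\<Sum>i<k. A (Suc i) 0 * u (Suc i) * u 0)"
      using Suc.prems(1) by (intro sum.cong) auto
    also have "(\<Sum>i<k. A (Suc i) 0 * u (Suc i) * u 0) = sqrt a * u 0 * (\<Sum>i<k. u (Suc i) * c i)"
      using a by (simp add: c_def sum_distrib_left mult_ac)
    also have "(\<Sum>i<k. \<Sum>j<k. A (Suc i) (Suc j) * u (Suc i) * u (Suc j))
        = (\<Sum>i<k. \<Sum>j<k. A' i j * u (Suc i) * u (Suc j)) + (\<Sum>i<k. u (Suc i) * c i)\<^sup>2"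
      unfolding power2_eq_square sum_product sum.distrib[symmetric]
      by (intro sum.cong) (auto simp: A'_def algebra_simps)
    finally show ?thesis using a by (simp add: power2_sum power_mult_distrib)
  qed
  have "\<exists>L. (\<forall>l<k. L l l > 0) \<and> (\<forall>i l. i < l \<longrightarrow> L i l = 0) \<and>
    (\<forall>u. (\<Sum>i<k. \<Sum>j<k. A' i j * u i * u j) = (\<Sum>l<k. (\<Sum>i<k. u i * L i l)\<^sup>2))"
  proof (rule Suc.IH)
    show "A' i j = A' j i" if "i < k" "j < k" for i j
      using that Suc.prems(1)[of "Suc i" "Suc j"] by (simp add: A'_def)
    fix u :: "nat \<Rightarrow> real" assume u: "\<exists>i<k. u i \<noteq> 0"
    \<comment> \<open>the first variable is chosen so that the completed square vanishes\<close>
    define v where "v i = (case i of 0 \<Rightarrow> - (\<Sum>i<k. u i * c i) / sqrt a | Suc i \<Rightarrow> u i)" for i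
    from u obtain i where "i < k" "u i \<noteq> 0" by auto
    then have "0 < (\<Sum>i<Suc k. \<Sum>j<Suc k. A i j * v i * v j)"
      by (intro Suc.prems(2) exI[of _ "Suc i"]) (auto simp: v_def)
    then show "0 < (\<Sum>i<k. \<Sum>j<k. A' i j * u i * u j)"
      unfolding split using a by (simp add: v_def)
  qed
  then obtain L where L: "\<And>l. l < k \<Longrightarrow> L l l > 0" "\<And>i l. i < l \<Longrightarrow> L i l = 0"
    "\<And>u. (\<Sum>i<k. \<Sum>j<k. A' i j * u i * u j) = (\<Sum>l<k. (\<Sum>i<k. u i * L i l)\<^sup>2)" by auto
  define L' where "L' i l = (case l of 0 \<Rightarrow> (case i of 0 \<Rightarrow> sqrt a | Suc i \<Rightarrow> c i)
      | Suc l \<Rightarrow> (case i of 0 \<Rightarrow> 0 | Suc i \<Rightarrow> L i l))" for i l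
  have L'_simps [simp]: "L' 0 0 = sqrt a" "L' (Suc i) 0 = c i" "L' 0 (Suc l) = 0" "L' (Suc i) (Suc l) = L i l" for i l
    by (auto simp: L'_def)
  show ?case
  proof (intro exI[of _ L'] conjI allI impI)
    show "L' l l > 0" if "l < Suc k" for l
      using that L(1) a by (cases l) auto
    show "L' i l = 0" if "i < l" for i l
      using that L(2) by (cases l; cases i) auto
    show "(\<Sum>i<Suc k. \<Sum>j<Suc k. A i j * u i * u j) = (\<Sum>l<Suc k. (\<Sum>i<Suc k. u i * L' i l)\<^sup>2)" for u
      unfolding split L(3) by (simp add: sum.lessThan_Suc_shift mult.commute del: sum.lessThan_Suc)
  qed
qed

text \<open>The system is \<open>L\<^sup>T u = v\<close>. Only its first equation contains \<open>u 0\<close>, so the others are solved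
  beforehand.\<close>

lemma triangular_solvable:
  fixes L :: "nat \<Rightarrow> nat \<Rightarrow> real"
  assumes "\<And>l. l < k \<Longrightarrow> L l l \<noteq> 0" "\<And>i l. i < l \<Longrightarrow> L i l = 0"
  shows "\<exists>u. \<forall>l<k. (\<Sum>i<k. u i * L i l) = v l"
  using assms
proof (induction k arbitrary: L v)
  case (Suc k)
  have "\<exists>u. \<forall>l<k. (\<Sum>i<k. u i * L (Suc i) (Suc l)) = v (Suc l)"
    by (rule Suc.IH) (use Suc.prems in auto)
  then obtain u where u: "\<And>l. l < k \<Longrightarrow> (\<Sum>i<k. u i * L (Suc i) (Suc l)) = v (Suc l)" by auto
  define w where "w i = (case i of 0 \<Rightarrow> (v 0 - (\<Sum>i<k. u i * L (Suc i) 0)) / L 0 0 | Suc i \<Rightarrow> u i)" for i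
  have "(\<Sum>i<Suc k. w i * L i l) = v l" if "l < Suc k" for l
    using that u Suc.prems
    by (cases l) (auto simp: sum.lessThan_Suc_shift w_def simp del: sum.lessThan_Suc)
  then show ?case by blast
qed auto

section \<open>Volume under triangular row operations\<close>

text \<open>Left multiplication by a lower triangular matrix \<open>L\<close>.\<close>

definition row_op :: "nat \<Rightarrow> nat \<Rightarrow> (nat \<Rightarrow> nat \<Rightarrow> real) \<Rightarrow> (nat \<times> nat \<Rightarrow> real) \<Rightarrow> nat \<times> nat \<Rightarrow> real" where
  "row_op k m L X = (\<lambda>(i, j)\<in>mat_idx k m. \<Sum>l\<le>i. L i l * X (l, j))"

text \<open>A shear combined with a scaling of one coordinate, by Fubini and the affine substitution on the
  real line.\<close>

lemma nn_integral_lborel_coordinate_affine: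
  fixes f :: "('i \<Rightarrow> real) \<Rightarrow> ennreal"
  assumes "finite I" "p \<in> I" "a > 0"
    and f [measurable]: "f \<in> borel_measurable (\<Pi>\<^sub>M i\<in>I. lborel)"
    and g [measurable]: "g \<in> borel_measurable (\<Pi>\<^sub>M i\<in>I - {p}. lborel)"
    and g_cong: "\<And>X y. g (X(p := y)) = g X"
  shows "(\<integral>\<^sup>+X. f X \<partial>(\<Pi>\<^sub>M i\<in>I. lborel))
    = ennreal a * (\<integral>\<^sup>+X. f (X(p := a * X p + g X)) \<partial>(\<Pi>\<^sub>M i\<in>I. lborel))"
proof -
  interpret product_sigma_finite "\<lambda>_. lborel :: real measure" ..
  have I: "I = insert p (I - {p})" using assms by auto
  define J where "J = I - {p}"
  have J: "I = insert p J" "finite J" "p \<notin> J" using assms by (auto simp: J_def)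
  have g' [measurable]: "g \<in> borel_measurable (\<Pi>\<^sub>M i\<in>insert p J. lborel)"
  proof -
    have "(\<lambda>X. g (restrict X J)) \<in> borel_measurable (\<Pi>\<^sub>M i\<in>insert p J. lborel)"
      using g unfolding J_def[symmetric]
      by (rule measurable_compose[rotated]) (intro measurable_restrict_subset, auto)
    moreover have "g (restrict X J) = g X" if "X \<in> space (\<Pi>\<^sub>M i\<in>insert p J. lborel)" for X
    proof -
      have "restrict X J = X(p := undefined)"
        using that J by (auto simp: space_PiM PiE_iff extensional_def restrict_def fun_eq_iff)
      then show ?thesis by (simp add: g_cong)
    qed
    ultimately show ?thesis by (subst measurable_cong[where g = "\<lambda>X. g (restrict X J)"]) auto
  qed
  have fJ [measurable]: "f \<in> borel_measurable (\<Pi>\<^sub>M i\<in>insert p J. lborel)" using f J by simp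
  have gJ [measurable]: "g \<in> borel_measurable (\<Pi>\<^sub>M i\<in>J. lborel)" using g J_def by simp
  have m: "(\<lambda>X. X(p := a * X p + g X)) \<in> measurable (\<Pi>\<^sub>M i\<in>insert p J. lborel) (\<Pi>\<^sub>M i\<in>insert p J. lborel)"
  proof (rule measurable_PiM_single')
    fix q assume q: "q \<in> insert p J"
    have "(\<lambda>X. X q') \<in> borel_measurable (\<Pi>\<^sub>M i\<in>insert p J. lborel)" if "q' \<in> insert p J" for q'
      using measurable_component_singleton[OF that, of "\<lambda>_. lborel"] by simp
    then show "(\<lambda>X. (X(p := a * X p + g X)) q) \<in> measurable (\<Pi>\<^sub>M i\<in>insert p J. lborel) lborel"
      using q g' by (cases "q = p") auto
  qed (auto simp: PiE_iff space_PiM extensional_def)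
  have "(\<integral>\<^sup>+X. f X \<partial>(\<Pi>\<^sub>M i\<in>insert p J. lborel)) = (\<integral>\<^sup>+X. (\<integral>\<^sup>+y. f (X(p := y)) \<partial>lborel) \<partial>(\<Pi>\<^sub>M i\<in>J. lborel))"
    using J by (intro product_nn_integral_insert) auto
  also have "\<dots> = (\<integral>\<^sup>+X. ennreal a * (\<integral>\<^sup>+y. f (X(p := g X + a * y)) \<partial>lborel) \<partial>(\<Pi>\<^sub>M i\<in>J. lborel))"
  proof (intro nn_integral_cong)
    fix X assume X: "X \<in> space (\<Pi>\<^sub>M i\<in>J. lborel :: real measure)"
    have "(\<lambda>y. f (X(p := y))) \<in> borel_measurable borel"
      using X J(3) by measurable
    then show "(\<integral>\<^sup>+y. f (X(p := y)) \<partial>lborel) = ennreal a * (\<integral>\<^sup>+y. f (X(p := g X + a * y)) \<partial>lborel)"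
      using \<open>a > 0\<close> by (subst nn_integral_real_affine[where c = a and t = "g X"]) auto
  qed
  also have "\<dots> = ennreal a * (\<integral>\<^sup>+X. (\<integral>\<^sup>+y. f (X(p := g X + a * y)) \<partial>lborel) \<partial>(\<Pi>\<^sub>M i\<in>J. lborel))"
  proof (intro nn_integral_cmult)
    have "(\<lambda>(X, y). X(p := g X + a * y)) \<in>
        measurable ((\<Pi>\<^sub>M i\<in>J. lborel) \<Otimes>\<^sub>M lborel) (\<Pi>\<^sub>M i\<in>insert p J. lborel)"
      by measurable
    then show "(\<lambda>X. \<integral>\<^sup>+y. f (X(p := g X + a * y)) \<partial>lborel) \<in> borel_measurable (\<Pi>\<^sub>M i\<in>J. lborel)"
      by measurable
  qed
  also have "(\<integral>\<^sup>+X. (\<integral>\<^sup>+y. f (X(p := g X + a * y)) \<partial>lborel) \<partial>(\<Pi>\<^sub>M i\<in>J. lborel))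
     = (\<integral>\<^sup>+X. (\<integral>\<^sup>+y. f ((X(p := y))(p := a * (X(p := y)) p + g (X(p := y)))) \<partial>lborel) \<partial>(\<Pi>\<^sub>M i\<in>J. lborel))"
    by (simp add: g_cong add.commute)
  also have "\<dots> = (\<integral>\<^sup>+X. f (X(p := a * X p + g X)) \<partial>(\<Pi>\<^sub>M i\<in>insert p J. lborel))"
    using J m by (intro product_nn_integral_insert[symmetric]) auto
  finally show ?thesis unfolding J(1)[symmetric] .
qed

text \<open>The triangular map is a composition of changes of single entries. The entries are replaced in order of
  decreasing row index, so that the entries above the current one, on which its new value depends, still
  have their original values.\<close>

lemma nn_integral_row_op_partial:
  assumes L: "\<And>i. i < k \<Longrightarrow> L i i > 0" and "finite Q" "Q \<subseteq> mat_idx k m"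
    and f: "f \<in> borel_measurable (mat_lebesgue k m)"
  shows "(\<lambda>X p. if p \<in> Q then row_op k m L X p else X p) \<in> measurable (mat_lebesgue k m) (mat_lebesgue k m) \<and>
    (\<integral>\<^sup>+X. f X \<partial>mat_lebesgue k m) = ennreal (\<Prod>p\<in>Q. L (fst p) (fst p)) *
      (\<integral>\<^sup>+X. f (\<lambda>p. if p \<in> Q then row_op k m L X p else X p) \<partial>mat_lebesgue k m)"
  using assms(2-)
proof (induction Q arbitrary: f rule: finite_ranking_induct[where f = "\<lambda>p. - int (fst p)"])
  case empty
  then show ?case by simp
next
  case (insert p Q)
  show ?case
  proof (cases "p \<in> Q")
    case True
    then show ?thesis using insert by (simp add: insert_absorb)
  next
    case False
    obtain i j where p: "p = (i, j)" by (cases p)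
    have pI: "p \<in> mat_idx k m" and ij: "i < k" "j < m" using insert.prems p by (auto simp: mat_idx_def)
    have Q: "Q \<subseteq> mat_idx k m" using insert.prems by auto
    define g where "g X = (\<Sum>l<i. L i l * X (l, j))" for X :: "nat \<times> nat \<Rightarrow> real"
    define E where "E X = X(p := L i i * X p + g X)" for X
    define T where "T Q X = (\<lambda>p. if p \<in> Q then row_op k m L X p else X p)" for Q X
    have mg: "g \<in> borel_measurable (\<Pi>\<^sub>M i\<in>mat_idx k m - {p}. lborel)"
      unfolding g_def
    proof (intro borel_measurable_sum borel_measurable_times borel_measurable_const)
      fix l assume "l \<in> {..<i}"
      then have "(l, j) \<in> mat_idx k m - {p}" using ij by (auto simp: p mat_idx_def)
      from measurable_component_singleton[OF this, of "\<lambda>_. lborel"]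
      show "(\<lambda>X. X (l, j)) \<in> borel_measurable (\<Pi>\<^sub>M i\<in>mat_idx k m - {p}. lborel)" by simp
    qed
    have comp: "(\<lambda>X. X q) \<in> borel_measurable (mat_lebesgue k m)" if "q \<in> mat_idx k m" for q
      using measurable_component_singleton[OF that, of "\<lambda>_. lborel"] by (simp add: mat_lebesgue_def)
    have mE: "E \<in> measurable (mat_lebesgue k m) (mat_lebesgue k m)"
      unfolding mat_lebesgue_def
    proof (rule measurable_PiM_single')
      fix q assume q: "q \<in> mat_idx k m"
      show "(\<lambda>X. E X q) \<in> measurable (\<Pi>\<^sub>M i\<in>mat_idx k m. lborel) lborel"
        using q pI ij comp unfolding mat_lebesgue_def[symmetric]
        by (cases "q = p") (auto simp: E_def g_def p mat_idx_def intro!: borel_measurable_sum)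
    qed (use pI in \<open>auto simp: E_def PiE_iff space_PiM extensional_def\<close>)
    have TE: "T (insert p Q) X = E (T Q X)" for X
    proof
      fix q
      have "T Q X (l, j) = X (l, j)" if "l < i" for l
      proof -
        have "(l, j) \<notin> Q" using insert.hyps(2)[of "(l, j)"] that p by auto
        then show ?thesis by (simp add: T_def)
      qed
      then show "T (insert p Q) X q = E (T Q X) q"
        using False pI
        by (auto simp: T_def E_def g_def row_op_def p lessThan_Suc_atMost[symmetric])
    qed
    from insert.IH[OF Q, of "\<lambda>X. f (E X)"] insert.prems mE
    have IH: "T Q \<in> measurable (mat_lebesgue k m) (mat_lebesgue k m)"
      "(\<integral>\<^sup>+X. f (E X) \<partial>mat_lebesgue k m) = ennreal (\<Prod>p\<in>Q. L (fst p) (fst p)) *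
      (\<integral>\<^sup>+X. f (E (T Q X)) \<partial>mat_lebesgue k m)"
      by (auto simp: T_def[abs_def])
    have "T (insert p Q) \<in> measurable (mat_lebesgue k m) (mat_lebesgue k m)"
      using measurable_compose[OF IH(1) mE] by (simp add: TE[abs_def])
    moreover have "(\<integral>\<^sup>+X. f X \<partial>mat_lebesgue k m) = ennreal (L i i) * (\<integral>\<^sup>+X. f (E X) \<partial>mat_lebesgue k m)"
      unfolding mat_lebesgue_def E_def
    proof (rule nn_integral_lborel_coordinate_affine[OF _ pI L[OF ij(1)] _ mg])
      show "g (X(p := y)) = g X" for X y by (simp add: g_def p)
      show "f \<in> borel_measurable (\<Pi>\<^sub>M i\<in>mat_idx k m. lborel)"
        using insert.prems(2) by (simp add: mat_lebesgue_def)
    qed (simp add: mat_idx_def)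
    moreover have "(\<Prod>p\<in>insert p Q. L (fst p) (fst p)) = L i i * (\<Prod>p\<in>Q. L (fst p) (fst p))"
      using False insert.hyps p by simp
    ultimately have "T (insert p Q) \<in> measurable (mat_lebesgue k m) (mat_lebesgue k m) \<and>
      (\<integral>\<^sup>+X. f X \<partial>mat_lebesgue k m) = ennreal (\<Prod>p\<in>insert p Q. L (fst p) (fst p)) *
        (\<integral>\<^sup>+X. f (T (insert p Q) X) \<partial>mat_lebesgue k m)"
      using L[OF ij(1)] by (simp add: IH(2) TE ennreal_mult' mult.assoc)
    then show ?thesis by (simp only: T_def[abs_def])
  qed
qed

lemma emeasure_row_op:
  assumes L: "\<And>i. i < k \<Longrightarrow> L i i > 0" and S: "S \<in> sets (mat_lebesgue k m)"
  shows "row_op k m L -` S \<inter> space (mat_lebesgue k m) \<in> sets (mat_lebesgue k m)"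
    and "emeasure (mat_lebesgue k m) S
    = ennreal ((\<Prod>i<k. L i i) ^ m) * emeasure (mat_lebesgue k m) (row_op k m L -` S \<inter> space (mat_lebesgue k m))"
proof -
  let ?M = "mat_lebesgue k m"
  let ?T = "\<lambda>X p. if p \<in> mat_idx k m then row_op k m L X p else X p"
  have T: "?T X = row_op k m L X" if "X \<in> space ?M" for X
    using that by (auto simp: row_op_def mat_lebesgue_def space_PiM PiE_iff extensional_def fun_eq_iff)
  have fin: "finite (mat_idx k m)" by (simp add: mat_idx_def)
  note * = nn_integral_row_op_partial[of k L "mat_idx k m" m "indicator S", OF L fin subset_refl]
  have mT: "?T \<in> measurable ?M ?M" using * S by auto
  have vT: "?T -` S \<inter> space ?M = row_op k m L -` S \<inter> space ?M" using T by auto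
  show **: "row_op k m L -` S \<inter> space ?M \<in> sets ?M"
    using measurable_sets[OF mT S] unfolding vT .
  have "emeasure ?M S = (\<integral>\<^sup>+X. indicator S X \<partial>?M)" using S by simp
  also have "\<dots> = ennreal (\<Prod>p\<in>mat_idx k m. L (fst p) (fst p)) * (\<integral>\<^sup>+X. indicator S (?T X) \<partial>?M)"
    using * S by auto
  also have "(\<integral>\<^sup>+X. indicator S (?T X) \<partial>?M) = (\<integral>\<^sup>+X. indicator (row_op k m L -` S \<inter> space ?M) X \<partial>?M)"
    by (intro nn_integral_cong) (auto simp: T split: split_indicator)
  also have "\<dots> = emeasure ?M (row_op k m L -` S \<inter> space ?M)" using ** by simp
  also have "(\<Prod>p\<in>mat_idx k m. L (fst p) (fst p)) = (\<Prod>i<k. L i i) ^ m"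
    using prod.cartesian_product[of "\<lambda>i j. L i i" "{..<m}" "{..<k}"]
    by (simp add: mat_idx_def case_prod_unfold prod_power_distrib)
  finally show "emeasure ?M S
    = ennreal ((\<Prod>i<k. L i i) ^ m) * emeasure ?M (row_op k m L -` S \<inter> space ?M)" .
qed

section \<open>Covering the Frobenius ball by cells of nearly constant Gram matrix\<close>

definition gram :: "nat \<Rightarrow> (nat \<times> nat \<Rightarrow> real) \<Rightarrow> nat \<Rightarrow> nat \<Rightarrow> real" where
  "gram m X a b = (\<Sum>j<m. X (a, j) * X (b, j))"

lemma gram_form_eq: "gram_form k m X u = (\<Sum>a<k. \<Sum>b<k. gram m X a b * u a * u b)"
proof -
  have "gram_form k m X u = (\<Sum>j<m. \<Sum>a<k. \<Sum>b<k. X (a, j) * X (b, j) * u a * u b)"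
    by (simp add: gram_form_def power2_eq_square sum_product mult_ac)
  also have "\<dots> = (\<Sum>a<k. \<Sum>j<m. \<Sum>b<k. X (a, j) * X (b, j) * u a * u b)"
    by (rule sum.swap)
  also have "\<dots> = (\<Sum>a<k. \<Sum>b<k. \<Sum>j<m. X (a, j) * X (b, j) * u a * u b)"
    by (intro sum.cong refl sum.swap)
  finally show ?thesis by (simp add: gram_def sum_distrib_right)
qed

lemma frob_norm_eq_trace: "(frob_norm k m X)\<^sup>2 = (\<Sum>a<k. gram m X a a)"
  unfolding mat_inner_self[symmetric] mat_inner_def gram_def by (rule sum.swap)

lemma abs_gram_le:
  assumes "a < k" "b < k"
  shows "\<bar>gram m X a b\<bar> \<le> (frob_norm k m X)\<^sup>2"
proof -
  have *: "gram m X a a \<le> (frob_norm k m X)\<^sup>2" if "a < k" for a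
    unfolding frob_norm_eq_trace using that
    by (intro member_le_sum[of a _ "\<lambda>a. gram m X a a"]) (auto simp: gram_def intro!: sum_nonneg)
  have "\<bar>gram m X a b\<bar> \<le> (\<Sum>j<m. \<bar>X (a, j) * X (b, j)\<bar>)"
    unfolding gram_def by (rule sum_abs)
  also have "\<dots> \<le> (\<Sum>j<m. (X (a, j) * X (a, j) + X (b, j) * X (b, j)) / 2)"
  proof (intro sum_mono)
    fix j
    have "0 \<le> (\<bar>X (a, j)\<bar> - \<bar>X (b, j)\<bar>)\<^sup>2" by simp
    then show "\<bar>X (a, j) * X (b, j)\<bar> \<le> (X (a, j) * X (a, j) + X (b, j) * X (b, j)) / 2"
      by (simp add: power2_eq_square algebra_simps abs_mult)
  qed
  also have "\<dots> = (gram m X a a + gram m X b b) / 2"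
    by (simp add: gram_def sum.distrib sum_divide_distrib[symmetric])
  also have "\<dots> \<le> ((frob_norm k m X)\<^sup>2 + (frob_norm k m X)\<^sup>2) / 2"
    using assms by (intro divide_right_mono add_mono *) auto
  finally show ?thesis by simp
qed

lemma continuous_on_gram: "continuous_on UNIV (\<lambda>X. gram m X a b)"
  unfolding gram_def by (intro continuous_intros continuous_on_product_coordinates)

lemma closed_spectral_ball: "closed (spectral_ball k m r)"
proof -
  have "spectral_ball k m r = mats k m \<inter> (\<Inter>u. {X. gram_form k m X u \<le> r\<^sup>2 * (\<Sum>i<k. (u i)\<^sup>2)})"
    by (auto simp: spectral_ball_def)
  moreover have "closed {X. gram_form k m X u \<le> r\<^sup>2 * (\<Sum>i<k. (u i)\<^sup>2)}" for u
    unfolding gram_form_eq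
    by (intro closed_Collect_le continuous_on_const continuous_on_sum continuous_on_mult continuous_on_gram)
  ultimately show ?thesis by (simp only:) (intro closed_Int closed_INT ballI closed_mats)
qed

definition gram_cell :: "nat \<Rightarrow> nat \<Rightarrow> real \<Rightarrow> (nat \<times> nat \<Rightarrow> real) \<Rightarrow> (nat \<times> nat \<Rightarrow> real) set" where
  "gram_cell k m d X\<^sub>0 = {X \<in> mats k m. \<forall>a<k. \<forall>b<k. \<bar>gram m X a b - gram m X\<^sub>0 a b\<bar> \<le> d}"

lemma closed_gram_cell: "closed (gram_cell k m d X\<^sub>0)"
proof -
  have "gram_cell k m d X\<^sub>0
      = mats k m \<inter> (\<Inter>a\<in>{..<k}. \<Inter>b\<in>{..<k}. {X. \<bar>gram m X a b - gram m X\<^sub>0 a b\<bar> \<le> d})"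
    by (auto simp: gram_cell_def)
  moreover have "closed {X. \<bar>gram m X a b - gram m X\<^sub>0 a b\<bar> \<le> d}" for a b
    by (intro closed_Collect_le continuous_on_const continuous_on_rabs continuous_on_diff continuous_on_gram)
  ultimately show ?thesis by (simp only:) (intro closed_Int closed_INT ballI closed_mats)
qed

lemma gram_form_row_op:
  assumes "\<And>i l. i < l \<Longrightarrow> L i l = 0"
  shows "gram_form k m (row_op k m L Z) u = gram_form k m Z (\<lambda>l. \<Sum>i<k. u i * L i l)"
  unfolding gram_form_def
proof (rule sum.cong[OF refl], rule arg_cong[of _ _ "\<lambda>x. x\<^sup>2"])
  fix j assume j: "j \<in> {..<m}"
  have "row_op k m L Z (i, j) = (\<Sum>l<k. L i l * Z (l, j))" if "i < k" for i
  proof -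
    have "row_op k m L Z (i, j) = (\<Sum>l\<le>i. L i l * Z (l, j))"
      using that j by (simp add: row_op_def mat_idx_def)
    also have "\<dots> = (\<Sum>l<k. L i l * Z (l, j))"
      using that assms by (intro sum.mono_neutral_left) auto
    finally show ?thesis .
  qed
  then have "(\<Sum>i<k. u i * row_op k m L Z (i, j)) = (\<Sum>i<k. \<Sum>l<k. u i * (L i l * Z (l, j)))"
    by (simp add: sum_distrib_left)
  also have "\<dots> = (\<Sum>l<k. \<Sum>i<k. u i * (L i l * Z (l, j)))" by (rule sum.swap)
  also have "\<dots> = (\<Sum>l<k. (\<Sum>i<k. u i * L i l) * Z (l, j))"
    by (simp add: sum_distrib_right mult.assoc)
  finally show "(\<Sum>i<k. u i * row_op k m L Z (i, j)) = (\<Sum>l<k. (\<Sum>i<k. u i * L i l) * Z (l, j))" .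
qed

text \<open>An entrywise perturbation of size \<open>d\<close> changes a quadratic form in \<open>k\<close> variables by at most
  \<open>d (\<Sum>i<k. \<bar>u i\<bar>)\<^sup>2\<close>.\<close>

lemma gram_form_le_on_gram_cell:
  assumes X: "X \<in> gram_cell k m d X\<^sub>0"
  shows "gram_form k m X u \<le> gram_form k m X\<^sub>0 u + d * real k * (\<Sum>i<k. (u i)\<^sup>2)"
proof (cases "k = 0")
  case False
  then have d: "d \<ge> 0" using X unfolding gram_cell_def by (smt (verit) mem_Collect_eq not_gr_zero)
  have "gram_form k m X u - gram_form k m X\<^sub>0 u
      = (\<Sum>a<k. \<Sum>b<k. (gram m X a b - gram m X\<^sub>0 a b) * (u a * u b))"
    unfolding gram_form_eq sum_subtractf[symmetric] by (simp add: algebra_simps)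
  also have "\<dots> \<le> (\<Sum>a<k. \<Sum>b<k. d * (\<bar>u a\<bar> * \<bar>u b\<bar>))"
  proof (intro sum_mono)
    fix a b assume "a \<in> {..<k}" "b \<in> {..<k}"
    then have d: "\<bar>gram m X a b - gram m X\<^sub>0 a b\<bar> \<le> d" using X by (simp add: gram_cell_def)
    have "(gram m X a b - gram m X\<^sub>0 a b) * (u a * u b) \<le> \<bar>(gram m X a b - gram m X\<^sub>0 a b) * (u a * u b)\<bar>"
      by (rule abs_ge_self)
    also have "\<dots> = \<bar>gram m X a b - gram m X\<^sub>0 a b\<bar> * (\<bar>u a\<bar> * \<bar>u b\<bar>)" by (simp only: abs_mult)
    also have "\<dots> \<le> d * (\<bar>u a\<bar> * \<bar>u b\<bar>)" using d by (rule mult_right_mono) simp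
    finally show "(gram m X a b - gram m X\<^sub>0 a b) * (u a * u b) \<le> d * (\<bar>u a\<bar> * \<bar>u b\<bar>)" .
  qed
  also have "\<dots> = d * (\<Sum>a<k. 1 * \<bar>u a\<bar>)\<^sup>2"
    unfolding power2_eq_square sum_product by (simp add: sum_distrib_left)
  also have "\<dots> \<le> d * ((\<Sum>a<k. 1\<^sup>2) * (\<Sum>a<k. \<bar>u a\<bar>\<^sup>2))"
    by (intro mult_left_mono Cauchy_Schwarz_ineq_sum d)
  finally show ?thesis by (simp add: mult.assoc)
qed (simp add: gram_form_def)

text \<open>The added multiple of the identity makes the bounding form positive definite even if \<open>X\<^sub>0\<close> has dependent
  rows, at the cost of the factor \<open>1 + 1 / m\<close> in its trace. After the volume change to the power \<open>m\<close>
  this factor contributes only a constant.\<close>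

lemma emeasure_gram_cell_le:
  assumes k: "k > 0" and m: "m > 0" and r: "r > 0" and X\<^sub>0: "frob_norm k m X\<^sub>0 \<le> r * sqrt (real k)"
  shows "emeasure (mat_lebesgue k m) (gram_cell k m (r\<^sup>2 / (real k * real m)) X\<^sub>0)
    \<le> ennreal (exp (real k / 2)) * emeasure (mat_lebesgue k m) (spectral_ball k m r)"
proof -
  let ?V = "gram_cell k m (r\<^sup>2 / (real k * real m)) X\<^sub>0" and ?M = "mat_lebesgue k m"
  \<comment> \<open>After division by \<open>r\<^sup>2\<close> the trace of \<open>A\<close> is at most \<open>k + k / m\<close>.\<close>
  define A where "A a b = gram m X\<^sub>0 a b / r\<^sup>2 + (if a = b then 1 / real m else 0)" for a b
  have A_form: "r\<^sup>2 * (\<Sum>a<k. \<Sum>b<k. A a b * u a * u b) = gram_form k m X\<^sub>0 u + r\<^sup>2 / real m * (\<Sum>i<k. (u i)\<^sup>2)" for u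
  proof -
    have "(\<Sum>a<k. \<Sum>b<k. A a b * u a * u b)
        = (\<Sum>a<k. \<Sum>b<k. gram m X\<^sub>0 a b * u a * u b / r\<^sup>2 + (if a = b then u a * u b / real m else 0))"
      by (intro sum.cong refl) (simp add: A_def distrib_right)
    also have "\<dots> = gram_form k m X\<^sub>0 u / r\<^sup>2 + (\<Sum>i<k. (u i)\<^sup>2) / real m"
      by (simp add: sum.distrib gram_form_eq sum_divide_distrib power2_eq_square)
    finally show ?thesis using r by (simp add: distrib_left)
  qed
  have pos: "(\<Sum>a<k. \<Sum>b<k. A a b * u a * u b) > 0" if u: "\<exists>i<k. u i \<noteq> 0" for u
  proof -
    obtain i where "i < k" "u i \<noteq> 0" using u by auto
    then have "(\<Sum>i<k. (u i)\<^sup>2) > 0" by (intro sum_pos2[of _ i]) auto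
    then have "r\<^sup>2 / real m * (\<Sum>i<k. (u i)\<^sup>2) > 0" using r m by simp
    then have "r\<^sup>2 * (\<Sum>a<k. \<Sum>b<k. A a b * u a * u b) > 0"
      unfolding A_form using gram_form_nonneg[of k m X\<^sub>0 u] by linarith
    then show ?thesis using r by (simp add: zero_less_mult_iff)
  qed
  have sym: "A a b = A b a" for a b by (simp add: A_def gram_def mult.commute)
  obtain L where L: "\<And>l. l < k \<Longrightarrow> L l l > 0" "\<And>i l. i < l \<Longrightarrow> L i l = 0"
    "\<And>u. (\<Sum>i<k. \<Sum>j<k. A i j * u i * u j) = (\<Sum>l<k. (\<Sum>i<k. u i * L i l)\<^sup>2)"
    using Cholesky_factorisation[of k A, OF sym pos] by blast
  have sub: "row_op k m L -` ?V \<inter> space ?M \<subseteq> spectral_ball k m r"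
  proof
    fix Z assume Z: "Z \<in> row_op k m L -` ?V \<inter> space ?M"
    have "gram_form k m Z v \<le> r\<^sup>2 * (\<Sum>l<k. (v l)\<^sup>2)" for v
    proof -
      have L0: "L l l \<noteq> 0" if "l < k" for l using L(1)[OF that] by simp
      obtain u where u: "\<And>l. l < k \<Longrightarrow> (\<Sum>i<k. u i * L i l) = v l"
        using triangular_solvable[of k L v, OF L0 L(2)] by blast
      have "gram_form k m Z v = gram_form k m (row_op k m L Z) u"
        by (subst gram_form_row_op) (simp_all add: L(2) gram_form_def u)
      also have "\<dots> \<le> gram_form k m X\<^sub>0 u + r\<^sup>2 / (real k * real m) * real k * (\<Sum>i<k. (u i)\<^sup>2)"
        using Z by (intro gram_form_le_on_gram_cell) auto
      also have "\<dots> = r\<^sup>2 * (\<Sum>a<k. \<Sum>b<k. A a b * u a * u b)"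
        unfolding A_form using k by simp
      also have "\<dots> = r\<^sup>2 * (\<Sum>l<k. (v l)\<^sup>2)" unfolding L(3) by (simp add: u)
      finally show ?thesis .
    qed
    then show "Z \<in> spectral_ball k m r"
      using Z by (auto simp: spectral_ball_def mat_lebesgue_def space_PiM mats_def)
  qed
  have det: "(\<Prod>i<k. L i i) ^ m \<le> exp (real k / 2)"
  proof -
    have diag: "(L i i)\<^sup>2 \<le> A i i" if i: "i < k" for i
    proof -
      let ?e = "\<lambda>j. if j = i then 1 else 0 :: real"
      have "(\<Sum>a<k. \<Sum>b<k. A a b * ?e a * ?e b) = (\<Sum>a<k. \<Sum>b<k. if b = i then (if a = i then A i i else 0) else 0)"
        by (intro sum.cong) auto
      then have "A i i = (\<Sum>a<k. \<Sum>b<k. A a b * ?e a * ?e b)" using i by simp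
      also have "\<dots> = (\<Sum>l<k. (L i l)\<^sup>2)"
      proof -
        have "(\<Sum>j<k. ?e j * L j l) = (\<Sum>j<k. if j = i then L i l else 0)" for l
          by (intro sum.cong) auto
        then show ?thesis unfolding L(3) using i by simp
      qed
      also have "\<dots> \<ge> (L i i)\<^sup>2" using i by (intro member_le_sum) auto
      finally show ?thesis .
    qed
    \<comment> \<open>The bound \<open>x \<le> exp ((x\<^sup>2 - 1) / 2)\<close> is sharp at \<open>x = 1\<close> and turns the product into the trace.\<close>
    have "(\<Prod>i<k. L i i) \<le> (\<Prod>i<k. exp (((L i i)\<^sup>2 - 1) / 2))"
    proof (intro prod_mono conjI)
      fix i assume "i \<in> {..<k}"
      then show "0 \<le> L i i" using L(1)[of i] by simp
      have "1 + ((L i i)\<^sup>2 - 1) / 2 - L i i = (L i i - 1)\<^sup>2 / 2"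
        by (simp add: power2_diff add_divide_distrib diff_divide_distrib)
      also have "\<dots> \<ge> 0" by simp
      finally have "L i i \<le> 1 + ((L i i)\<^sup>2 - 1) / 2" by (rule diff_ge_0_iff_ge[THEN iffD1])
      also have "\<dots> \<le> exp (((L i i)\<^sup>2 - 1) / 2)" by (rule exp_ge_add_one_self)
      finally show "L i i \<le> exp (((L i i)\<^sup>2 - 1) / 2)" .
    qed
    also have "\<dots> = exp (\<Sum>i<k. ((L i i)\<^sup>2 - 1) / 2)" by (simp add: exp_sum)
    also have "\<dots> \<le> exp (real k / (2 * real m))"
    proof -
      have "(\<Sum>i<k. (L i i)\<^sup>2) \<le> (\<Sum>i<k. A i i)" using diag by (intro sum_mono) auto
      also have "\<dots> = (frob_norm k m X\<^sub>0)\<^sup>2 / r\<^sup>2 + real k / real m"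
        by (simp add: A_def sum.distrib frob_norm_eq_trace sum_divide_distrib)
      also have "\<dots> \<le> (r * sqrt (real k))\<^sup>2 / r\<^sup>2 + real k / real m"
        using X\<^sub>0 by (intro add_right_mono divide_right_mono power_mono frob_norm_nonneg) simp_all
      also have "(r * sqrt (real k))\<^sup>2 / r\<^sup>2 = real k"
        using r by (simp add: power_mult_distrib)
      finally have "(\<Sum>i<k. (L i i)\<^sup>2) \<le> real k + real k / real m" .
      then have "(\<Sum>i<k. ((L i i)\<^sup>2 - 1) / 2) \<le> real k / real m / 2"
        by (simp add: sum_divide_distrib[symmetric] sum_subtractf)
      then show ?thesis by (simp add: mult.commute)
    qed
    finally have "(\<Prod>i<k. L i i) ^ m \<le> exp (real k / (2 * real m)) ^ m"
      using less_imp_le[OF L(1)] by (intro power_mono prod_nonneg) simp_all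
    also have "\<dots> = exp (real k / 2)"
      using m by (simp add: exp_of_nat_mult[symmetric])
    finally show ?thesis .
  qed
  have V: "?V \<in> sets ?M"
    by (rule closed_imp_sets_mat_lebesgue[OF closed_gram_cell]) (auto simp: gram_cell_def)
  have U: "spectral_ball k m r \<in> sets ?M"
    by (rule closed_imp_sets_mat_lebesgue[OF closed_spectral_ball]) (auto simp: spectral_ball_def)
  have "emeasure ?M ?V = ennreal ((\<Prod>i<k. L i i) ^ m) * emeasure ?M (row_op k m L -` ?V \<inter> space ?M)"
    by (rule emeasure_row_op(2)[OF L(1) V])
  also have "\<dots> \<le> ennreal (exp (real k / 2)) * emeasure ?M (spectral_ball k m r)"
    by (intro mult_mono ennreal_leI det emeasure_mono sub U) auto
  finally show ?thesis .
qed

text \<open>Two matrices whose Gram entries, in units of the cell size, have the same integer parts lie in each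
  other's cells. In these units the entries are at most \<open>k\<^sup>2 m\<close> in absolute value, which leaves
  \<open>2 k\<^sup>2 m + 1\<close> integer parts for each of the \<open>k\<^sup>2\<close> entries.\<close>

lemma finite_gram_cell_cover:
  assumes k: "k > 0" and m: "m > 0" and r: "r > 0"
    and B: "\<And>X. X \<in> B \<Longrightarrow> X \<in> mats k m \<and> frob_norm k m X \<le> r * sqrt (real k)"
  obtains P where "finite P" "P \<subseteq> B" "card P \<le> (2 * k\<^sup>2 * m + 1) ^ k\<^sup>2"
    "B \<subseteq> (\<Union>X\<^sub>0\<in>P. gram_cell k m (r\<^sup>2 / (real k * real m)) X\<^sub>0)"
proof -
  define s where "s = real k * real m / r\<^sup>2"
  have s: "s > 0" using assms by (simp add: s_def)
  define f where "f X = (\<lambda>(a, b)\<in>{..<k} \<times> {..<k}. \<lfloor>gram m X a b * s\<rfloor>)" for X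
  let ?n = "int (k\<^sup>2 * m)"
  let ?T = "PiE ({..<k} \<times> {..<k}) (\<lambda>_. {- ?n..?n})"
  have fT: "f ` B \<subseteq> ?T"
  proof (intro image_subsetI PiE_I)
    fix X p assume X: "X \<in> B" and p: "p \<in> {..<k} \<times> {..<k}"
    obtain a b where ab: "p = (a, b)" "a < k" "b < k" using p by auto
    have "\<bar>gram m X a b * s\<bar> = \<bar>gram m X a b\<bar> * s" using s by (simp add: abs_mult)
    also have "\<dots> \<le> (r * sqrt (real k))\<^sup>2 * s"
    proof (intro mult_right_mono)
      have "\<bar>gram m X a b\<bar> \<le> (frob_norm k m X)\<^sup>2" using ab by (intro abs_gram_le)
      also have "\<dots> \<le> (r * sqrt (real k))\<^sup>2"
        using B[OF X] by (intro power_mono frob_norm_nonneg) simp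
      finally show "\<bar>gram m X a b\<bar> \<le> (r * sqrt (real k))\<^sup>2" .
    qed (use s in simp)
    also have "\<dots> = real_of_int ?n"
      using r by (simp add: s_def power_mult_distrib power2_eq_square)
    finally have "- real_of_int ?n \<le> gram m X a b * s" "gram m X a b * s \<le> real_of_int ?n"
      by linarith+
    then have "- ?n \<le> \<lfloor>gram m X a b * s\<rfloor>" "\<lfloor>gram m X a b * s\<rfloor> \<le> ?n" by linarith+
    then show "f X p \<in> {- ?n..?n}" using ab by (simp add: f_def)
  qed (auto simp: f_def)
  have finT: "finite ?T" by (intro finite_PiE) auto
  have cardT: "card ?T = (2 * k\<^sup>2 * m + 1) ^ k\<^sup>2"
    by (simp add: card_PiE power2_eq_square nat_add_distrib nat_mult_distrib algebra_simps)
  define P where "P = inv_into B f ` f ` B"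
  have fin: "finite (f ` B)" using fT finT by (rule finite_subset)
  show ?thesis
  proof
    show "finite P" using fin by (simp add: P_def)
    show "P \<subseteq> B" unfolding P_def by (auto intro: inv_into_into)
    have "card P \<le> card (f ` B)" unfolding P_def using fin by (rule card_image_le)
    also have "\<dots> \<le> card ?T" using finT fT by (rule card_mono)
    finally show "card P \<le> (2 * k\<^sup>2 * m + 1) ^ k\<^sup>2" unfolding cardT .
    show "B \<subseteq> (\<Union>X\<^sub>0\<in>P. gram_cell k m (r\<^sup>2 / (real k * real m)) X\<^sub>0)"
    proof
      fix X assume X: "X \<in> B"
      define X\<^sub>0 where "X\<^sub>0 = inv_into B f (f X)"
      have X\<^sub>0: "X\<^sub>0 \<in> P" "f X\<^sub>0 = f X" using X by (auto simp: X\<^sub>0_def P_def f_inv_into_f)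
      have "\<bar>gram m X a b - gram m X\<^sub>0 a b\<bar> \<le> r\<^sup>2 / (real k * real m)" if "a < k" "b < k" for a b
      proof -
        have "\<lfloor>gram m X a b * s\<rfloor> = \<lfloor>gram m X\<^sub>0 a b * s\<rfloor>"
          using fun_cong[OF X\<^sub>0(2), of "(a, b)"] that by (simp add: f_def)
        then have "\<bar>gram m X a b * s - gram m X\<^sub>0 a b * s\<bar> \<le> 1" by linarith
        then have "\<bar>gram m X a b - gram m X\<^sub>0 a b\<bar> * s \<le> 1"
          using s by (simp add: left_diff_distrib[symmetric] abs_mult)
        then have "\<bar>gram m X a b - gram m X\<^sub>0 a b\<bar> \<le> 1 / s" using s by (simp add: field_simps)
        then show ?thesis by (simp add: s_def)
      qed
      then have "X \<in> gram_cell k m (r\<^sup>2 / (real k * real m)) X\<^sub>0"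
        using B[OF X] by (simp add: gram_cell_def)
      then show "X \<in> (\<Union>X\<^sub>0\<in>P. gram_cell k m (r\<^sup>2 / (real k * real m)) X\<^sub>0)" using X\<^sub>0(1) by blast
    qed
  qed
qed

lemma emeasure_frob_ball_le:
  assumes k: "k > 0" and m: "m > 0" and r: "r > 0"
    and B: "\<And>X. X \<in> B \<Longrightarrow> X \<in> mats k m \<and> frob_norm k m X \<le> r * sqrt (real k)"
  shows "emeasure (mat_lebesgue k m) B
    \<le> ennreal (real ((2 * k\<^sup>2 * m + 1) ^ k\<^sup>2) * exp (real k / 2)) * emeasure (mat_lebesgue k m) (spectral_ball k m r)"
proof -
  let ?M = "mat_lebesgue k m" and ?V = "gram_cell k m (r\<^sup>2 / (real k * real m))"
  let ?c = "ennreal (exp (real k / 2)) * emeasure ?M (spectral_ball k m r)"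
  obtain P where P: "finite P" "P \<subseteq> B" "card P \<le> (2 * k\<^sup>2 * m + 1) ^ k\<^sup>2" "B \<subseteq> (\<Union>X\<^sub>0\<in>P. ?V X\<^sub>0)"
    by (rule finite_gram_cell_cover[OF k m r B])
  have V: "?V X\<^sub>0 \<in> sets ?M" for X\<^sub>0
    by (rule closed_imp_sets_mat_lebesgue[OF closed_gram_cell]) (auto simp: gram_cell_def)
  have "emeasure ?M B \<le> emeasure ?M (\<Union>X\<^sub>0\<in>P. ?V X\<^sub>0)"
    using P V by (intro emeasure_mono sets.finite_UN) auto
  also have "\<dots> \<le> (\<Sum>X\<^sub>0\<in>P. emeasure ?M (?V X\<^sub>0))"
    using P V by (intro emeasure_subadditive_finite) auto
  also have "\<dots> \<le> (\<Sum>X\<^sub>0\<in>P. ?c)"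
    using P B by (intro sum_mono emeasure_gram_cell_le k m r) auto
  also have "\<dots> = ennreal (real (card P)) * ?c"
    by (simp add: ennreal_of_nat_eq_real_of_nat)
  also have "\<dots> \<le> ennreal (real ((2 * k\<^sup>2 * m + 1) ^ k\<^sup>2)) * ?c"
    using P(3) by (intro mult_right_mono ennreal_leI of_nat_mono) auto
  also have "\<dots> = ennreal (real ((2 * k\<^sup>2 * m + 1) ^ k\<^sup>2) * exp (real k / 2)) * emeasure ?M (spectral_ball k m r)"
    by (simp only: ennreal_mult'[OF of_nat_0_le_iff] mult.assoc)
  finally show ?thesis .
qed

section \<open>Comparison of the volumes\<close>

lemma emeasure_bounded_mats_finite:
  assumes "\<And>X. X \<in> B \<Longrightarrow> X \<in> mats k m \<and> (\<forall>p\<in>mat_idx k m. \<bar>X p\<bar> \<le> c)"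
  shows "emeasure (mat_lebesgue k m) B < \<infinity>"
proof -
  interpret product_sigma_finite "\<lambda>_. lborel :: real measure" ..
  have "emeasure (mat_lebesgue k m) (PiE (mat_idx k m) (\<lambda>_. {- c..c})) = (\<Prod>p\<in>mat_idx k m. emeasure lborel {- c..c})"
    unfolding mat_lebesgue_def by (rule emeasure_PiM) auto
  also have "\<dots> = (\<Prod>p\<in>mat_idx k m. ennreal (if - c \<le> c then c - (- c) else 0))"
    by (simp only: emeasure_lborel_Icc_eq)
  also have "\<dots> = ennreal (\<Prod>p\<in>mat_idx k m. if - c \<le> c then c - (- c) else 0)"
    by (rule prod_ennreal) simp
  also have "\<dots> < \<infinity>" by simp
  finally have "emeasure (mat_lebesgue k m) (PiE (mat_idx k m) (\<lambda>_. {- c..c})) < \<infinity>" .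
  moreover have "emeasure (mat_lebesgue k m) B \<le> emeasure (mat_lebesgue k m) (PiE (mat_idx k m) (\<lambda>_. {- c..c}))"
  proof (rule emeasure_mono)
    show "B \<subseteq> PiE (mat_idx k m) (\<lambda>_. {- c..c})"
    proof
      fix X assume "X \<in> B"
      then have "X \<in> mats k m" "\<And>p. p \<in> mat_idx k m \<Longrightarrow> - c \<le> X p \<and> X p \<le> c"
        using assms by (auto simp: abs_le_iff minus_le_iff)
      then show "X \<in> PiE (mat_idx k m) (\<lambda>_. {- c..c})"
        unfolding mats_def PiE_iff by simp
    qed
    show "PiE (mat_idx k m) (\<lambda>_. {- c..c}) \<in> sets (mat_lebesgue k m)"
      unfolding mat_lebesgue_def by (intro sets_PiM_I_finite) auto
  qed
  ultimately show ?thesis by (rule le_less_trans[rotated])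
qed

lemma mat_volume_sandwich:
  assumes k: "k > 0" and m: "m > 0"
  shows "mat_volume k m (segre_zonoid k m) \<le> mat_volume k m (segre_ball k m)"
    and "mat_volume k m (segre_ball k m)
      \<le> real ((2 * k\<^sup>2 * m + 1) ^ k\<^sup>2) * exp (real k / 2) * mat_volume k m (segre_zonoid k m)"
proof -
  let ?M = "mat_lebesgue k m" and ?C = "segre_body k m" and ?B = "segre_ball k m"
  let ?c = "real ((2 * k\<^sup>2 * m + 1) ^ k\<^sup>2) * exp (real k / 2)"
  define r where "r = rho k / (real k * sqrt (2 * pi))"
  have r: "r > 0" using rho_pos[OF k] k by (simp add: r_def)
  have R: "1 / sqrt (2 * pi) * (rho k / sqrt (real k)) = r * sqrt (real k)"
    using k real_sqrt_pow2[of "real k"] by (simp add: r_def field_simps flip: power2_eq_square)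
  have B: "X \<in> mats k m \<and> frob_norm k m X \<le> r * sqrt (real k)" if "X \<in> ?B" for X
    using that unfolding segre_ball_def R by simp
  have B_closed: "closed ?B"
  proof -
    have "?B = mats k m \<inter> {X. frob_norm k m X \<le> r * sqrt (real k)}"
      unfolding segre_ball_def R by auto
    moreover have "closed {X. frob_norm k m X \<le> r * sqrt (real k)}"
      unfolding frob_norm_def
      by (intro closed_Collect_le continuous_on_const continuous_on_real_sqrt continuous_on_mat_inner continuous_on_id)
    ultimately show ?thesis by (simp only:) (intro closed_Int closed_INT ballI closed_mats)
  qed
  have sets: "?B \<in> sets ?M" "?C \<in> sets ?M"
    using closed_imp_sets_mat_lebesgue[OF B_closed]
      closed_imp_sets_mat_lebesgue[OF compact_imp_closed, of ?C k m] convex_body_segre_body[OF k, of m]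
    by (auto simp: segre_ball_def convex_body_def)
  have fin: "emeasure ?M ?B < \<infinity>"
    by (rule emeasure_bounded_mats_finite[where c = "r * sqrt (real k)"])
      (auto dest: B intro: order_trans[OF entry_le_frob_norm])
  have CB: "emeasure ?M ?C \<le> emeasure ?M ?B"
    using segre_body_subset_ball[OF k] sets by (intro emeasure_mono)
  then have finC: "emeasure ?M ?C < \<infinity>" using fin by (rule le_less_trans)
  show "mat_volume k m (segre_zonoid k m) \<le> mat_volume k m ?B"
    unfolding segre_zonoid_eq[OF k] mat_volume_def measure_def
    using CB fin by (intro enn2real_mono) auto
  have "emeasure ?M ?B \<le> ennreal ?c * emeasure ?M (spectral_ball k m r)"
    by (rule emeasure_frob_ball_le[OF k m r B])
  also have "\<dots> \<le> ennreal ?c * emeasure ?M ?C"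
    using spectral_ball_subset_segre_body[OF k, of m] sets unfolding r_def
    by (intro mult_left_mono emeasure_mono) auto
  finally have "emeasure ?M ?B \<le> ennreal ?c * emeasure ?M ?C" .
  then have "measure ?M ?B \<le> enn2real (ennreal ?c * emeasure ?M ?C)"
    unfolding measure_def using finC by (intro enn2real_mono) (auto simp: ennreal_mult_less_top)
  also have "\<dots> = ?c * measure ?M ?C"
    by (simp add: enn2real_mult measure_def)
  finally show "mat_volume k m ?B \<le> ?c * mat_volume k m (segre_zonoid k m)"
    unfolding segre_zonoid_eq[OF k] mat_volume_def .
qed

theorem theorem6p3:
  fixes k :: nat
  assumes "k \<ge> 1"
  shows "(\<lambda>m. ln (mat_volume k m (segre_zonoid k m)) - ln (mat_volume k m (segre_ball k m)))
           \<in> O(\<lambda>m. ln (real m))"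
proof (rule bigoI)
  let ?c = "real (k\<^sup>2) * (ln (3 * real (k\<^sup>2)) / ln 2 + 1) + real k / (2 * ln 2)"
  show "eventually (\<lambda>m. norm (ln (mat_volume k m (segre_zonoid k m)) - ln (mat_volume k m (segre_ball k m)))
      \<le> ?c * norm (ln (real m))) sequentially"
  proof (rule eventually_mono[OF eventually_ge_at_top[of 2]])
    fix m :: nat assume m: "m \<ge> 2"
    have k: "k > 0" using assms by simp
    let ?N = "real ((2 * k\<^sup>2 * m + 1) ^ k\<^sup>2) * exp (real k / 2)"
    define C where "C = mat_volume k m (segre_zonoid k m)"
    define B where "B = mat_volume k m (segre_ball k m)"
    have CB: "C \<le> B" "B \<le> ?N * C"
      using mat_volume_sandwich[OF k, of m] m by (auto simp: C_def B_def)
    have N1: "1 \<le> ?N"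
      unfolding of_nat_power by (intro mult_ge1_I one_le_power) simp_all
    have C0: "C \<ge> 0" by (simp add: C_def mat_volume_def)
    have k1: "real (k\<^sup>2) \<ge> 1" using assms by simp
    have m2: "ln (real m) \<ge> ln 2" using m by simp
    have c: "ln ?N \<le> ?c * ln (real m)"
    proof -
      have "ln ?N = real (k\<^sup>2) * ln (real (2 * k\<^sup>2 * m + 1)) + real k / 2"
      proof -
        have "ln ?N = ln (real (2 * k\<^sup>2 * m + 1) ^ k\<^sup>2) + ln (exp (real k / 2))"
          unfolding of_nat_power
          by (intro ln_mult_pos zero_less_power) (simp_all add: add_pos_nonneg)
        then show ?thesis by (simp add: ln_realpow del: of_nat_add of_nat_mult)
      qed
      also have "\<dots> \<le> real (k\<^sup>2) * ln (3 * real (k\<^sup>2) * real m) + real k / 2"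
      proof -
        have "1 \<le> real (k\<^sup>2) * real m" using k1 m by (simp add: mult_ge1_I)
        then have "2 * (real (k\<^sup>2) * real m) + 1 \<le> 2 * (real (k\<^sup>2) * real m) + real (k\<^sup>2) * real m"
          by (rule add_left_mono)
        then have "real (2 * k\<^sup>2 * m + 1) \<le> 3 * real (k\<^sup>2) * real m" by simp
        moreover have "0 < real (2 * k\<^sup>2 * m + 1)" unfolding of_nat_0_less_iff by simp
        ultimately have "ln (real (2 * k\<^sup>2 * m + 1)) \<le> ln (3 * real (k\<^sup>2) * real m)" by (intro ln_mono)
        then show ?thesis by (simp add: mult_left_mono)
      qed
      also have "ln (3 * real (k\<^sup>2) * real m) = ln (3 * real (k\<^sup>2)) + ln (real m)"
        using k m by (intro ln_mult_pos) auto
      also have "real (k\<^sup>2) * (ln (3 * real (k\<^sup>2)) + ln (real m)) + real k / 2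
          \<le> real (k\<^sup>2) * (ln (3 * real (k\<^sup>2)) / ln 2 * ln (real m) + ln (real m)) + real k / (2 * ln 2) * ln (real m)"
      proof -
        have *: "a \<le> a / ln 2 * ln (real m)" if "a \<ge> 0" for a :: real
          using mult_left_mono[OF m2, of "a / ln 2"] that by simp
        have "ln (3 * real (k\<^sup>2)) \<ge> 0" using k1 by (intro ln_ge_zero) simp
        from *[OF this] *[of "real k / 2"] show ?thesis
          by (intro add_mono mult_left_mono) auto
      qed
      finally show ?thesis by (simp add: algebra_simps)
    qed
    have "\<bar>ln C - ln B\<bar> \<le> ?c * ln (real m)"
    \<comment> \<open>If one of the volumes vanishes, then so does the other, and both logarithms are \<open>ln 0 = 0\<close>.\<close>
    proof (cases "C = 0")
      case True
      then have "B = 0" using CB by simp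
      have "0 \<le> ln ?N" using N1 by (rule ln_ge_zero)
      then show ?thesis using True \<open>B = 0\<close> c by simp
    next
      case False
      then have pos: "C > 0" "B > 0" using C0 CB by auto
      have "ln B \<le> ln (?N * C)" using CB pos by (intro ln_mono) auto
      also have "\<dots> = ln ?N + ln C" using pos less_le_trans[OF zero_less_one N1] by (intro ln_mult_pos)
      finally have "ln B - ln C \<le> ln ?N" by simp
      moreover have "ln C \<le> ln B" using CB pos by simp
      ultimately show ?thesis using c by simp
    qed
    moreover have "norm (ln (real m)) = ln (real m)" using m by simp
    ultimately show "norm (ln (mat_volume k m (segre_zonoid k m)) - ln (mat_volume k m (segre_ball k m)))
      \<le> ?c * norm (ln (real m))"
      by (simp only: real_norm_def C_def B_def)
  qed
qed

end
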